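(* Let $\mathbb{D}_Q\subseteq\mathbb{M}^d$ be a nc operator ball. For $X\in\mathbb{D}_Q(n)$ let $\Phi_X\colon H^\infty(\mathbb{D}_Q)\to M_n$, $\Phi_X(F)=F(X)$, and for $\eta\in M_n^*$ let $\varphi_{X,\eta}=\eta\circ\Phi_X\in H^\infty(\mathbb{D}_Q)^*$. Let $$\mathcal{X}(\mathbb{D}_Q)=\overline{\operatorname{span}}\{\varphi_{X,\eta}:\ n\in\mathbb{N},\ X\in\mathbb{D}_Q(n),\ \eta\in M_n^*\}\subseteq H^\infty(\mathbb{D}_Q)^*$$ (norm closure). Then $\mathcal{X}(\mathbb{D}_Q)$ is a predual of $H^\infty(\mathbb{D}_Q)$, and it is the unique predual $\mathcal{X}$ of $H^\infty(\mathbb{D}_Q)$ for which $\Phi_X$ is $\sigma(H^\infty(\mathbb{D}_Q),\mathcal{X})$-continuous for every $X\in\mathbb{D}_Q$.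
   Context: $M_n$ is the algebra of complex $n\times n$ matrices with operator norm, $M_n^d$ the set of $d$-tuples, $\mathbb{M}^d=\bigsqcup_{n\ge1}M_n^d$, and $\Omega(n)=\Omega\cap M_n^d$ for $\Omega\subseteq\mathbb{M}^d$. Direct sums are coordinatewise, and $S\cdot X=(S^{-1}X_1S,\dots,S^{-1}X_dS)$ for $S\in GL_n(\mathbb{C})$. A nc set is a subset of $\mathbb{M}^d$ closed under direct sums. A nc function $F\colon\Omega\to\mathbb{M}^e$ on a nc set is a map with $F(\Omega(n))\subseteq M_n^e$, $F(X\oplus Y)=F(X)\oplus F(Y)$, and $F(S\cdot X)=S\cdot F(X)$ whenever $X,S\cdot X\in\Omega(n)$, $S\in GL_n(\mathbb{C})$. Let $\mathcal{R},\mathcal{S}$ be Hilbert spaces and $Q_1,\dots,Q_d\in\mathcal{L}(\mathcal{R},\mathcal{S})$ linearly independent. Put $Q(X)=\sum_{j=1}^dQ_j\otimes X_j\in\mathcal{L}(\mathcal{R}^n,\mathcal{S}^n)$ for $X\in M_n^d$. The nc operator ball of $Q$ is $\mathbb{D}_Q=\{X\in\mathbb{M}^d:\|Q(X)\|<1\}$. $H^\infty(\mathbb{D}_Q)$ is the Banach algebra of nc functions $F\colon\mathbb{D}_Q\to\mathbb{M}^1$ with $\|F\|_\infty=\sup_{X\in\mathbb{D}_Q}\|F(X)\|<\infty$. For a Banach space $\mathcal{Y}$, a norm-closed subspace $\mathcal{X}\subseteq\mathcal{Y}^*$ is called a predual of $\mathcal{Y}$ if the canonical map $\mathcal{Y}\to\mathcal{X}^*$,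 $y\mapsto(\varphi\mapsto\varphi(y))$, is an isometric isomorphism onto $\mathcal{X}^*$. $\sigma(\mathcal{Y},\mathcal{X})$ is the weakest topology on $\mathcal{Y}$ making every $\varphi\in\mathcal{X}$ continuous. *)

theory Defs
  imports
    "HOL-Analysis.Analysis"
    "HOL-Library.FuncSet"
    "Jordan_Normal_Form.Matrix"
    "Jordan_Normal_Form.Gauss_Jordan_Elimination"
begin

section \<open>Complex Hilbert spaces\<close>

class complex_hilbert = banach +
  fixes scaleC :: "complex \<Rightarrow> 'a \<Rightarrow> 'a"  (infixr "*\<^sub>C" 75)
    and cinner :: "'a \<Rightarrow> 'a \<Rightarrow> complex"
  assumes scaleC_add_right: "a *\<^sub>C (x + y) = a *\<^sub>C x + a *\<^sub>C y"
    and scaleC_add_left: "(a + b) *\<^sub>C x = a *\<^sub>C x + b *\<^sub>C x"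
    and scaleC_scaleC: "a *\<^sub>C b *\<^sub>C x = (a * b) *\<^sub>C x"
    and scaleC_one: "1 *\<^sub>C x = x"
    and scaleR_scaleC: "scaleR r x = complex_of_real r *\<^sub>C x"
    and cinner_commute: "cinner x y = cnj (cinner y x)"
    and cinner_add_right: "cinner x (y + z) = cinner x y + cinner x z"
    and cinner_scaleC_right: "cinner x (a *\<^sub>C y) = a * cinner x y"
    and cinner_self: "cinner x x = complex_of_real ((norm x)\<^sup>2)"

instantiation complex :: complex_hilbert
begin

definition scaleC_complex :: "complex \<Rightarrow> complex \<Rightarrow> complex" where
  "scaleC_complex a x = a * x"

definition cinner_complex :: "complex \<Rightarrow> complex \<Rightarrow> complex" where
  "cinner_complex x y = cnj x * y"

instance
proof
  fix a b x y z :: complex and r :: real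
  show "a *\<^sub>C (x + y) = a *\<^sub>C x + a *\<^sub>C y" "(a + b) *\<^sub>C x = a *\<^sub>C x + b *\<^sub>C x"
    by (simp_all add: scaleC_complex_def ring_distribs)
  show "a *\<^sub>C b *\<^sub>C x = (a * b) *\<^sub>C x" "1 *\<^sub>C x = x" "scaleR r x = complex_of_real r *\<^sub>C x"
    by (simp_all add: scaleC_complex_def scaleR_conv_of_real)
  show "cinner x y = cnj (cinner y x)" "cinner x (a *\<^sub>C y) = a * cinner x y"
    by (simp_all add: scaleC_complex_def cinner_complex_def)
  show "cinner x (y + z) = cinner x y + cinner x z"
    by (simp add: cinner_complex_def ring_distribs)
  show "cinner x x = complex_of_real ((norm x)\<^sup>2)"
    unfolding cinner_complex_def by (metis complex_norm_square mult.commute)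
qed

end

definition bounded_clinear :: "('r::complex_hilbert \<Rightarrow> 's::complex_hilbert) \<Rightarrow> bool" where
  "bounded_clinear T \<longleftrightarrow> bounded_linear T \<and> (\<forall>a x. T (a *\<^sub>C x) = a *\<^sub>C T x)"

text \<open>Linear independence of the indexed family \<open>Q\<close>, so that repetitions are excluded.\<close>

definition clin_independent :: "('d::finite \<Rightarrow> 'r::complex_hilbert \<Rightarrow> 's::complex_hilbert) \<Rightarrow> bool" where
  "clin_independent Q \<longleftrightarrow>
     (\<forall>c :: 'd \<Rightarrow> complex. (\<forall>x. (\<Sum>j\<in>UNIV. c j *\<^sub>C Q j x) = 0) \<longrightarrow> (\<forall>j. c j = 0))"


section \<open>Complex normed spaces with an explicit carrier\<close>

text \<open>
  The spaces below depend on \<open>n\<close>, on \<open>Q\<close> or on other spaces, so they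
  cannot be types. Spaces of functions consist of functions that are extensional (equal to
  \<open>undefined\<close> outside their domain), so that equality in HOL is equality on
  the domain.
\<close>

record 'a cnspace =
  vcarrier :: "'a set"
  vadd :: "'a \<Rightarrow> 'a \<Rightarrow> 'a"
  vscale :: "complex \<Rightarrow> 'a \<Rightarrow> 'a"
  vnorm :: "'a \<Rightarrow> real"

text \<open>The guard makes this a total metric in the sense of the locale \<open>Metric_space\<close>,
  which asks for nonnegativity and symmetry also outside the carrier.\<close>

definition vdist :: "'a cnspace \<Rightarrow> 'a \<Rightarrow> 'a \<Rightarrow> real" where
  "vdist V x y = (if x \<in> vcarrier V \<and> y \<in> vcarrier V
     then vnorm V (vadd V x (vscale V (- 1) y)) else 0)"

definition norm_topology :: "'a cnspace \<Rightarrow> 'a topology" where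
  "norm_topology V = Metric_space.mtopology (vcarrier V) (vdist V)"

definition vsubspace :: "'a cnspace \<Rightarrow> 'a set \<Rightarrow> bool" where
  "vsubspace V U \<longleftrightarrow> U \<subseteq> vcarrier V \<and> U \<noteq> {} \<and>
     (\<forall>x\<in>U. \<forall>y\<in>U. vadd V x y \<in> U) \<and> (\<forall>a. \<forall>x\<in>U. vscale V a x \<in> U)"

definition vspan :: "'a cnspace \<Rightarrow> 'a set \<Rightarrow> 'a set" where
  "vspan V A = vsubspace V hull A"

definition linear_map :: "'a cnspace \<Rightarrow> 'b cnspace \<Rightarrow> ('a \<Rightarrow> 'b) \<Rightarrow> bool" where
  "linear_map V W T \<longleftrightarrow> T \<in> vcarrier V \<rightarrow> vcarrier W \<and>
     (\<forall>x\<in>vcarrier V. \<forall>y\<in>vcarrier V. T (vadd V x y) = vadd W (T x) (T y)) \<and>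
     (\<forall>a. \<forall>x\<in>vcarrier V. T (vscale V a x) = vscale W a (T x))"

definition bounded_linear_map :: "'a cnspace \<Rightarrow> 'b cnspace \<Rightarrow> ('a \<Rightarrow> 'b) \<Rightarrow> bool" where
  "bounded_linear_map V W T \<longleftrightarrow> linear_map V W T \<and>
     (\<exists>C. \<forall>x\<in>vcarrier V. vnorm W (T x) \<le> C * vnorm V x)"

definition opnorm :: "'a cnspace \<Rightarrow> 'b cnspace \<Rightarrow> ('a \<Rightarrow> 'b) \<Rightarrow> real" where
  "opnorm V W T = (SUP x\<in>{x \<in> vcarrier V. vnorm V x \<le> 1}. vnorm W (T x))"

definition isometric_isomorphism :: "'a cnspace \<Rightarrow> 'b cnspace \<Rightarrow> ('a \<Rightarrow> 'b) \<Rightarrow> bool" where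
  "isometric_isomorphism V W T \<longleftrightarrow> linear_map V W T \<and>
     bij_betw T (vcarrier V) (vcarrier W) \<and> (\<forall>x\<in>vcarrier V. vnorm W (T x) = vnorm V x)"

definition complex_field_space :: "complex cnspace" where
  "complex_field_space = \<lparr>vcarrier = UNIV, vadd = (+), vscale = (*), vnorm = cmod\<rparr>"

definition dual_space :: "'a cnspace \<Rightarrow> ('a \<Rightarrow> complex) cnspace" where
  "dual_space V = \<lparr>
     vcarrier = {\<phi> \<in> extensional (vcarrier V). bounded_linear_map V complex_field_space \<phi>},
     vadd = (\<lambda>\<phi> \<psi>. \<lambda>x\<in>vcarrier V. \<phi> x + \<psi> x),
     vscale = (\<lambda>a \<phi>. \<lambda>x\<in>vcarrier V. a * \<phi> x),
     vnorm = opnorm V complex_field_space\<rparr>"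

definition predual :: "'a cnspace \<Rightarrow> ('a \<Rightarrow> complex) set \<Rightarrow> bool" where
  "predual Y X \<longleftrightarrow>
     vsubspace (dual_space Y) X \<and> closedin (norm_topology (dual_space Y)) X \<and>
     isometric_isomorphism Y (dual_space ((dual_space Y)\<lparr>vcarrier := X\<rparr>)) (\<lambda>y. \<lambda>\<phi>\<in>X. \<phi> y)"

text \<open>\<open>\<sigma>(Y, X)\<close>; the whole carrier is added to the subbasis so that it is the
  underlying set of the topology even for empty \<open>X\<close>.\<close>

definition weak_topology :: "'a cnspace \<Rightarrow> ('a \<Rightarrow> complex) set \<Rightarrow> 'a topology" where
  "weak_topology Y X = topology_generated_by
     (insert (vcarrier Y) {{y \<in> vcarrier Y. \<phi> y \<in> U} | \<phi> U. \<phi> \<in> X \<and> open U})"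


section \<open>Matrices with the operator norm\<close>

definition cvec_space :: "nat \<Rightarrow> complex Matrix.vec cnspace" where
  "cvec_space n = \<lparr>vcarrier = carrier_vec n, vadd = (+), vscale = smult_vec,
     vnorm = (\<lambda>v. L2_set (\<lambda>i. cmod (vec_index v i)) {..<dim_vec v})\<rparr>"

definition mat_norm :: "complex mat \<Rightarrow> real" where
  "mat_norm A = opnorm (cvec_space (dim_col A)) (cvec_space (dim_row A)) (mult_mat_vec A)"

definition mat_space :: "nat \<Rightarrow> complex mat cnspace" where
  "mat_space n = \<lparr>vcarrier = carrier_mat n n, vadd = (+), vscale = smult_mat, vnorm = mat_norm\<rparr>"


section \<open>Noncommutative sets and functions\<close>

text \<open>A tuple indexed by the finite type \<open>'d\<close> represents an element of
  \<open>\<M>\<^sup>d\<close> with \<open>d = CARD('d)\<close>.\<close>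

definition nc_level :: "nat \<Rightarrow> ('d::finite \<Rightarrow> complex mat) set" where
  "nc_level n = {X. \<forall>j. X j \<in> carrier_mat n n}"

definition nc_universe :: "('d::finite \<Rightarrow> complex mat) set" where
  "nc_universe = (\<Union>n\<in>{1..}. nc_level n)"

definition nc_dsum ::
  "('d::finite \<Rightarrow> complex mat) \<Rightarrow> ('d \<Rightarrow> complex mat) \<Rightarrow> ('d \<Rightarrow> complex mat)" where
  "nc_dsum X Y = (\<lambda>j. four_block_mat
     (X j) (0\<^sub>m (dim_row (X j)) (dim_col (Y j)))
     (0\<^sub>m (dim_row (Y j)) (dim_col (X j))) (Y j))"

text \<open>\<open>mat_inverse S\<close> is \<open>Some\<close> of the inverse of \<open>S\<close> exactly for invertible \<open>S\<close>.\<close>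

definition nc_sim :: "complex mat \<Rightarrow> ('d::finite \<Rightarrow> complex mat) \<Rightarrow> ('d \<Rightarrow> complex mat)" where
  "nc_sim S X = (\<lambda>j. the (mat_inverse S) * X j * S)"

definition GL :: "nat \<Rightarrow> complex mat set" where
  "GL n = {S \<in> carrier_mat n n. invertible_mat S}"

definition nc_set :: "('d::finite \<Rightarrow> complex mat) set \<Rightarrow> bool" where
  "nc_set \<Omega> \<longleftrightarrow> \<Omega> \<subseteq> nc_universe \<and> (\<forall>X\<in>\<Omega>. \<forall>Y\<in>\<Omega>. nc_dsum X Y \<in> \<Omega>)"

definition nc_function ::
  "('d::finite \<Rightarrow> complex mat) set \<Rightarrow> (('d \<Rightarrow> complex mat) \<Rightarrow> ('e::finite \<Rightarrow> complex mat)) \<Rightarrow> bool" where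
  "nc_function \<Omega> F \<longleftrightarrow> nc_set \<Omega> \<and>
     (\<forall>n\<ge>1. F ` (\<Omega> \<inter> nc_level n) \<subseteq> nc_level n) \<and>
     (\<forall>X\<in>\<Omega>. \<forall>Y\<in>\<Omega>. F (nc_dsum X Y) = nc_dsum (F X) (F Y)) \<and>
     (\<forall>n\<ge>1. \<forall>S\<in>GL n. \<forall>X\<in>\<Omega> \<inter> nc_level n.
        nc_sim S X \<in> \<Omega> \<inter> nc_level n \<longrightarrow> F (nc_sim S X) = nc_sim S (F X))"


section \<open>Operator balls and bounded noncommutative functions\<close>

definition hilbert_power :: "nat \<Rightarrow> (nat \<Rightarrow> 'r::complex_hilbert) cnspace" where
  "hilbert_power n = \<lparr>vcarrier = extensional {..<n},
     vadd = (\<lambda>v w. \<lambda>i\<in>{..<n}. v i + w i),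
     vscale = (\<lambda>a v. \<lambda>i\<in>{..<n}. a *\<^sub>C v i),
     vnorm = (\<lambda>v. L2_set (\<lambda>i. norm (v i)) {..<n})\<rparr>"

text \<open>\<open>Q(X) = \<Sum>j. Q j \<otimes> X j\<close>, where \<open>T \<otimes> A\<close> acts on \<open>n\<close>-tuples as the operator matrix
  with entries \<open>A $$ (i, k) *\<^sub>C T\<close>.\<close>

definition pencil :: "nat \<Rightarrow> ('d::finite \<Rightarrow> 'r::complex_hilbert \<Rightarrow> 's::complex_hilbert) \<Rightarrow>
    ('d \<Rightarrow> complex mat) \<Rightarrow> (nat \<Rightarrow> 'r) \<Rightarrow> (nat \<Rightarrow> 's)" where
  "pencil n Q X v = (\<lambda>i\<in>{..<n}. \<Sum>j\<in>UNIV. \<Sum>k<n. (X j $$ (i, k)) *\<^sub>C Q j (v k))"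

definition nc_ball ::
  "('d::finite \<Rightarrow> 'r::complex_hilbert \<Rightarrow> 's::complex_hilbert) \<Rightarrow> ('d \<Rightarrow> complex mat) set" where
  "nc_ball Q =
     (\<Union>n\<in>{1..}. {X \<in> nc_level n. opnorm (hilbert_power n) (hilbert_power n) (pencil n Q X) < 1})"

text \<open>\<open>\<M>\<^sup>1\<close> is identified with the type of matrices, a 1-tuple being a function on \<open>unit\<close>.\<close>

definition H_infinity :: "('d::finite \<Rightarrow> 'r::complex_hilbert \<Rightarrow> 's::complex_hilbert) \<Rightarrow>
    (('d \<Rightarrow> complex mat) \<Rightarrow> complex mat) cnspace" where
  "H_infinity Q = \<lparr>
     vcarrier = {F \<in> extensional (nc_ball Q).
       nc_function (nc_ball Q) (\<lambda>X (_::unit). F X) \<and> bdd_above ((\<lambda>X. mat_norm (F X)) ` nc_ball Q)},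
     vadd = (\<lambda>F G. \<lambda>X\<in>nc_ball Q. F X + G X),
     vscale = (\<lambda>a F. \<lambda>X\<in>nc_ball Q. a \<cdot>\<^sub>m F X),
     vnorm = (\<lambda>F. SUP X\<in>nc_ball Q. mat_norm (F X))\<rparr>"

definition evaluation :: "('d::finite \<Rightarrow> complex mat) \<Rightarrow>
    (('d \<Rightarrow> complex mat) \<Rightarrow> complex mat) \<Rightarrow> complex mat" where
  "evaluation X F = F X"

definition eval_functional :: "('d::finite \<Rightarrow> 'r::complex_hilbert \<Rightarrow> 's::complex_hilbert) \<Rightarrow>
    ('d \<Rightarrow> complex mat) \<Rightarrow> (complex mat \<Rightarrow> complex) \<Rightarrow>
    (('d \<Rightarrow> complex mat) \<Rightarrow> complex mat) \<Rightarrow> complex" where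
  "eval_functional Q X \<eta> = (\<lambda>F\<in>vcarrier (H_infinity Q). \<eta> (evaluation X F))"

definition canonical_predual :: "('d::finite \<Rightarrow> 'r::complex_hilbert \<Rightarrow> 's::complex_hilbert) \<Rightarrow>
    ((('d \<Rightarrow> complex mat) \<Rightarrow> complex mat) \<Rightarrow> complex) set" where
  "canonical_predual Q =
     Abstract_Topology.closure_of (norm_topology (dual_space (H_infinity Q)))
       (vspan (dual_space (H_infinity Q))
         {eval_functional Q X \<eta> | n X \<eta>.
            1 \<le> n \<and> X \<in> nc_ball Q \<inter> nc_level n \<and> \<eta> \<in> vcarrier (dual_space (mat_space n))})"

definition evaluations_continuous :: "('d::finite \<Rightarrow> 'r::complex_hilbert \<Rightarrow> 's::complex_hilbert) \<Rightarrow>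
    ((('d \<Rightarrow> complex mat) \<Rightarrow> complex mat) \<Rightarrow> complex) set \<Rightarrow> bool" where
  "evaluations_continuous Q \<X> \<longleftrightarrow> (\<forall>n\<ge>1. \<forall>X\<in>nc_ball Q \<inter> nc_level n.
     continuous_map (weak_topology (H_infinity Q) \<X>) (norm_topology (mat_space n)) (evaluation X))"

end

theory Submission
  imports Defs
begin

text \<open>
  Write \<open>\<H>\<close> for the Banach algebra \<open>H\<^sup>\<infinity>(\<D>\<^sub>Q)\<close>. Both halves of the theorem rest on the same
  observation: a noncommutative function is exactly a graded family of matrices that satisfies
  linear relations between its values, and each of these relations is an equality between point
  functionals \<open>\<phi>\<^bsub>X,\<eta>\<^esub>\<close> on \<open>\<H>\<close>.

  Existence. Let \<open>\<Lambda>\<close> be a bounded functional on the canonical space. Applied to the functionals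
  \<open>F \<mapsto> F(X)\<^sub>i\<^sub>j\<close> it yields the entries of a matrix \<open>F(X)\<close> for every \<open>X\<close> in the ball. By linearity
  \<open>\<Lambda>(\<phi>\<^bsub>X,\<eta>\<^esub>) = \<eta>(F(X))\<close> for every \<open>\<eta>\<close>, so \<open>F\<close> respects direct sums and similarities because the
  point functionals do, and \<open>\<parallel>F(X)\<parallel> \<le> \<parallel>\<Lambda>\<parallel>\<close> because the norm of a matrix is computed by functionals
  \<open>A \<mapsto> \<langle>A u, v\<rangle>\<close> with unit vectors \<open>u\<close>, \<open>v\<close>, whose point functionals have norm at most one
  (\<open>functional_represented_on_points\<close>). Thus \<open>\<Lambda>\<close> is evaluation at \<open>F\<close> on the span of the point
  functionals, and on its closure by continuity. The same vector functionals show that the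
  canonical map is isometric (\<open>canonical_map_isometric\<close>).

  Uniqueness. Let \<open>K\<close> be a predual for which the evaluations are continuous. Each point functional
  is then continuous for \<open>\<sigma>(\<H>, K)\<close>, and a linear functional that is continuous for this topology
  vanishes on a finite intersection of kernels of elements of \<open>K\<close>, hence belongs to \<open>K\<close>
  (\<open>functional_in_subspace_if_vanishes_on_kernels\<close>). So \<open>K\<close> contains the canonical predual. If the
  inclusion were proper, the Hahn-Banach theorem (\<open>separating_functional\<close>) would give a nonzero
  functional on \<open>K\<close> that annihilates the canonical predual; as \<open>K\<close> is a predual, this functional is
  evaluation at some \<open>F \<in> \<H>\<close>, and \<open>F\<close> is zero since the canonical predual determines it.

  The Hahn-Banach theorem is proved for spaces with an explicit carrier by minimal sublinear
  functionals: below every sublinear functional there is a minimal one by Zorn's lemma, and a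
  minimal one is additive because it cannot be lowered in any direction.
\<close>

section \<open>Complex normed spaces on an explicit carrier\<close>

text \<open>
  The record has no zero vector. The other axioms do not force the vectors \<open>0 \<cdot> x\<close> to coincide
  (a disjoint union of vector spaces indexed by a semilattice is a counterexample), so
  \<open>zero_exists\<close> asks for it.
\<close>

locale complex_normed_space =
  fixes V :: "'a cnspace"
  assumes add_closed: "\<lbrakk>x \<in> vcarrier V; y \<in> vcarrier V\<rbrakk> \<Longrightarrow> vadd V x y \<in> vcarrier V"
    and add_assoc: "\<lbrakk>x \<in> vcarrier V; y \<in> vcarrier V; z \<in> vcarrier V\<rbrakk> \<Longrightarrow>
      vadd V (vadd V x y) z = vadd V x (vadd V y z)"
    and add_commute: "\<lbrakk>x \<in> vcarrier V; y \<in> vcarrier V\<rbrakk> \<Longrightarrow> vadd V x y = vadd V y x"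
    and scale_closed: "x \<in> vcarrier V \<Longrightarrow> vscale V a x \<in> vcarrier V"
    and scale_scale: "x \<in> vcarrier V \<Longrightarrow> vscale V a (vscale V b x) = vscale V (a * b) x"
    and scale_one: "x \<in> vcarrier V \<Longrightarrow> vscale V 1 x = x"
    and scale_add_left: "x \<in> vcarrier V \<Longrightarrow>
      vscale V (a + b) x = vadd V (vscale V a x) (vscale V b x)"
    and scale_add_right: "\<lbrakk>x \<in> vcarrier V; y \<in> vcarrier V\<rbrakk> \<Longrightarrow>
      vscale V a (vadd V x y) = vadd V (vscale V a x) (vscale V a y)"
    and zero_exists: "\<exists>z\<in>vcarrier V. \<forall>x\<in>vcarrier V. vscale V 0 x = z"
    and norm_triangle: "\<lbrakk>x \<in> vcarrier V; y \<in> vcarrier V\<rbrakk> \<Longrightarrow>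
      vnorm V (vadd V x y) \<le> vnorm V x + vnorm V y"
    and norm_scale: "x \<in> vcarrier V \<Longrightarrow> vnorm V (vscale V a x) = cmod a * vnorm V x"
    and norm_eq_zero_imp: "\<lbrakk>x \<in> vcarrier V; vnorm V x = 0\<rbrakk> \<Longrightarrow> vscale V 0 x = x"
begin

abbreviation carrier ("\<C>") where "\<C> \<equiv> vcarrier V"
abbreviation plus (infixl "\<boxplus>" 65) where "x \<boxplus> y \<equiv> vadd V x y"
abbreviation scale (infixr "\<boxdot>" 75) where "a \<boxdot> x \<equiv> vscale V a x"
abbreviation norm_of ("\<parallel>_\<parallel>") where "\<parallel>x\<parallel> \<equiv> vnorm V x"

definition zero ("\<zero>\<^sub>V") where "\<zero>\<^sub>V = (THE z. z \<in> \<C> \<and> (\<forall>x\<in>\<C>. 0 \<boxdot> x = z))"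

lemma zero_closed [simp]: "\<zero>\<^sub>V \<in> \<C>"
  and scale_zero_left [simp]: "x \<in> \<C> \<Longrightarrow> 0 \<boxdot> x = \<zero>\<^sub>V"
proof -
  obtain z where z: "z \<in> \<C>" "\<forall>x\<in>\<C>. 0 \<boxdot> x = z"
    using zero_exists by blast
  have "\<zero>\<^sub>V = z"
    unfolding zero_def by (rule the_equality) (use z in auto)
  then show "\<zero>\<^sub>V \<in> \<C>" "x \<in> \<C> \<Longrightarrow> 0 \<boxdot> x = \<zero>\<^sub>V"
    using z by auto
qed

declare add_closed [simp] scale_closed [simp] scale_scale [simp] scale_one [simp]

lemma add_left_commute:
  "\<lbrakk>x \<in> \<C>; y \<in> \<C>; z \<in> \<C>\<rbrakk> \<Longrightarrow> x \<boxplus> (y \<boxplus> z) = y \<boxplus> (x \<boxplus> z)"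
  by (metis add_assoc add_commute)

lemmas add_ac = add_assoc add_commute add_left_commute

lemma add_zero_right [simp]: "x \<in> \<C> \<Longrightarrow> x \<boxplus> \<zero>\<^sub>V = x"
  using scale_add_left[of x 1 0] by simp

lemma add_zero_left [simp]: "x \<in> \<C> \<Longrightarrow> \<zero>\<^sub>V \<boxplus> x = x"
  by (simp add: add_commute[of "\<zero>\<^sub>V"])

lemma scale_zero_right [simp]: "a \<boxdot> \<zero>\<^sub>V = \<zero>\<^sub>V"
  using scale_scale[of "\<zero>\<^sub>V" a 0] by simp

lemma add_minus_right [simp]: "x \<in> \<C> \<Longrightarrow> x \<boxplus> (- 1) \<boxdot> x = \<zero>\<^sub>V"
  using scale_add_left[of x 1 "- 1"] by simp

lemma add_minus_left [simp]: "x \<in> \<C> \<Longrightarrow> (- 1) \<boxdot> x \<boxplus> x = \<zero>\<^sub>V"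
  by (simp add: add_commute[of _ x])

lemma add_minus_cancel [simp]: "\<lbrakk>x \<in> \<C>; y \<in> \<C>\<rbrakk> \<Longrightarrow> (x \<boxplus> y) \<boxplus> (- 1) \<boxdot> y = x"
  by (simp add: add_assoc)

lemma minus_add_cancel [simp]: "\<lbrakk>x \<in> \<C>; y \<in> \<C>\<rbrakk> \<Longrightarrow> (x \<boxplus> (- 1) \<boxdot> y) \<boxplus> y = x"
  by (simp add: add_assoc)

lemma norm_zero [simp]: "\<parallel>\<zero>\<^sub>V\<parallel> = 0"
  using norm_scale[of "\<zero>\<^sub>V" 0] by simp

lemma norm_minus [simp]: "x \<in> \<C> \<Longrightarrow> \<parallel>(- 1) \<boxdot> x\<parallel> = \<parallel>x\<parallel>"
  by (simp add: norm_scale)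

lemma norm_nonneg [simp]: "x \<in> \<C> \<Longrightarrow> 0 \<le> \<parallel>x\<parallel>"
  using norm_triangle[of x "(- 1) \<boxdot> x"] by simp

lemma norm_eq_zero: "x \<in> \<C> \<Longrightarrow> \<parallel>x\<parallel> = 0 \<longleftrightarrow> x = \<zero>\<^sub>V"
  using norm_eq_zero_imp[of x] by auto

lemma diff_eq_zero: "\<lbrakk>x \<in> \<C>; y \<in> \<C>\<rbrakk> \<Longrightarrow> x \<boxplus> (- 1) \<boxdot> y = \<zero>\<^sub>V \<longleftrightarrow> x = y"
  by (metis add_minus_right add_zero_left minus_add_cancel)

lemma minus_diff: "\<lbrakk>x \<in> \<C>; y \<in> \<C>\<rbrakk> \<Longrightarrow> (- 1) \<boxdot> (x \<boxplus> (- 1) \<boxdot> y) = y \<boxplus> (- 1) \<boxdot> x"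
  by (simp add: scale_add_right add_commute)

lemma diff_add_diff:
  "\<lbrakk>x \<in> \<C>; y \<in> \<C>; z \<in> \<C>\<rbrakk> \<Longrightarrow> (x \<boxplus> (- 1) \<boxdot> y) \<boxplus> (y \<boxplus> (- 1) \<boxdot> z) = x \<boxplus> (- 1) \<boxdot> z"
  by (metis add_assoc add_closed minus_add_cancel scale_closed)

lemma Metric_space: "Metric_space \<C> (vdist V)"
proof
  fix x y
  show "0 \<le> vdist V x y"
    by (simp add: vdist_def)
  show "vdist V x y = vdist V y x"
    unfolding vdist_def by (metis add_closed minus_diff norm_minus scale_closed)
next
  fix x y assume "x \<in> \<C>" "y \<in> \<C>"
  then show "vdist V x y = 0 \<longleftrightarrow> x = y"
    by (simp add: vdist_def norm_eq_zero diff_eq_zero)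
next
  fix x y z assume "x \<in> \<C>" "y \<in> \<C>" "z \<in> \<C>"
  then show "vdist V x z \<le> vdist V x y + vdist V y z"
    using norm_triangle[of "x \<boxplus> (- 1) \<boxdot> y" "y \<boxplus> (- 1) \<boxdot> z"] by (simp add: vdist_def diff_add_diff)
qed

sublocale metric: Metric_space \<C> "vdist V"
  by (rule Metric_space)

lemma topspace_norm_topology [simp]: "topspace (norm_topology V) = \<C>"
  by (simp add: norm_topology_def)

lemma closedin_norm_topology:
  "closedin (norm_topology V) S \<longleftrightarrow>
     S \<subseteq> \<C> \<and> (\<forall>x\<in>\<C> - S. \<exists>r>0. \<forall>u\<in>S. r \<le> \<parallel>x \<boxplus> (- 1) \<boxdot> u\<parallel>)"
proof -
  have *: "(\<exists>r>0. metric.mball x r \<subseteq> \<C> - S) \<longleftrightarrow> (\<exists>r>0. \<forall>u\<in>S. r \<le> \<parallel>x \<boxplus> (- 1) \<boxdot> u\<parallel>)"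
    if "S \<subseteq> \<C>" "x \<in> \<C>" for x
  proof (intro ex_cong1 conj_cong refl)
    fix r :: real
    have "metric.mball x r \<subseteq> \<C> - S \<longleftrightarrow> (\<forall>u\<in>S. \<not> vdist V x u < r)"
      using that by (auto simp: metric.mball_def)
    also have "\<dots> \<longleftrightarrow> (\<forall>u\<in>S. r \<le> \<parallel>x \<boxplus> (- 1) \<boxdot> u\<parallel>)"
      using that by (intro ball_cong) (auto simp: vdist_def not_less)
    finally show "metric.mball x r \<subseteq> \<C> - S \<longleftrightarrow> (\<forall>u\<in>S. r \<le> \<parallel>x \<boxplus> (- 1) \<boxdot> u\<parallel>)" .
  qed
  have "openin metric.mtopology (\<C> - S) \<longleftrightarrow> (\<forall>x\<in>\<C> - S. \<exists>r>0. \<forall>u\<in>S. r \<le> \<parallel>x \<boxplus> (- 1) \<boxdot> u\<parallel>)"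
    if "S \<subseteq> \<C>"
    unfolding metric.openin_mtopology using *[OF that] by auto
  then show ?thesis
    unfolding norm_topology_def closedin_def metric.topspace_mtopology by blast
qed

lemma closure_of_norm_topology:
  assumes "S \<subseteq> \<C>"
  shows "Abstract_Topology.closure_of (norm_topology V) S = {x \<in> \<C>. \<forall>r>0. \<exists>u\<in>S. \<parallel>x \<boxplus> (- 1) \<boxdot> u\<parallel> < r}"
  unfolding norm_topology_def metric.metric_closure_of using assms
  by (fastforce simp: vdist_def)

lemma vsubspaceD:
  assumes "vsubspace V U"
  shows "U \<subseteq> \<C>" "\<And>x y. \<lbrakk>x \<in> U; y \<in> U\<rbrakk> \<Longrightarrow> x \<boxplus> y \<in> U" "\<And>a x. x \<in> U \<Longrightarrow> a \<boxdot> x \<in> U" "\<zero>\<^sub>V \<in> U"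
proof -
  show 1: "U \<subseteq> \<C>" and "\<And>x y. \<lbrakk>x \<in> U; y \<in> U\<rbrakk> \<Longrightarrow> x \<boxplus> y \<in> U"
    and 2: "\<And>a x. x \<in> U \<Longrightarrow> a \<boxdot> x \<in> U"
    using assms by (auto simp: vsubspace_def)
  obtain u where "u \<in> U"
    using assms by (auto simp: vsubspace_def)
  then show "\<zero>\<^sub>V \<in> U"
    using 1 2[of u 0] by auto
qed

lemma vsubspace_vspan:
  assumes "A \<subseteq> \<C>" shows "vsubspace V (vspan V A)"
proof -
  have whole: "vsubspace V \<C>"
    using zero_closed by (force simp: vsubspace_def simp del: zero_closed)
  have "\<zero>\<^sub>V \<in> vspan V A"
    unfolding vspan_def hull_def by (auto dest: vsubspaceD)
  moreover have "vspan V A \<subseteq> \<C>"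
    unfolding vspan_def by (intro hull_minimal assms whole)
  ultimately show ?thesis
    unfolding vsubspace_def vspan_def hull_def by blast
qed

lemma vsubspace_closure:
  assumes U: "vsubspace V U"
  shows "vsubspace V (Abstract_Topology.closure_of (norm_topology V) U)"
proof -
  note D = vsubspaceD[OF U]
  note cl = closure_of_norm_topology[OF D(1)]
  have "x \<boxplus> y \<in> Abstract_Topology.closure_of (norm_topology V) U"
    if x: "x \<in> Abstract_Topology.closure_of (norm_topology V) U"
      and y: "y \<in> Abstract_Topology.closure_of (norm_topology V) U" for x y
  proof -
    have xy: "x \<in> \<C>" "y \<in> \<C>"
      using x y cl by auto
    have "\<exists>u\<in>U. \<parallel>(x \<boxplus> y) \<boxplus> (- 1) \<boxdot> u\<parallel> < r" if "0 < r" for r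
    proof -
      have "0 < r / 2"
        using \<open>0 < r\<close> by simp
      then obtain u v where uv: "u \<in> U" "\<parallel>x \<boxplus> (- 1) \<boxdot> u\<parallel> < r / 2" "v \<in> U" "\<parallel>y \<boxplus> (- 1) \<boxdot> v\<parallel> < r / 2"
        using x y unfolding cl by blast
      then have "u \<in> \<C>" "v \<in> \<C>"
        using D(1) by auto
      then have "(x \<boxplus> y) \<boxplus> (- 1) \<boxdot> (u \<boxplus> v) = (x \<boxplus> (- 1) \<boxdot> u) \<boxplus> (y \<boxplus> (- 1) \<boxdot> v)"
        using xy by (simp add: scale_add_right add_ac)
      then have "\<parallel>(x \<boxplus> y) \<boxplus> (- 1) \<boxdot> (u \<boxplus> v)\<parallel> < r"
        using norm_triangle[of "x \<boxplus> (- 1) \<boxdot> u" "y \<boxplus> (- 1) \<boxdot> v"] xy uv \<open>u \<in> \<C>\<close> \<open>v \<in> \<C>\<close> by simp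
      then show ?thesis
        using D(2) uv by blast
    qed
    then show ?thesis
      using xy by (simp add: cl)
  qed
  moreover have "a \<boxdot> x \<in> Abstract_Topology.closure_of (norm_topology V) U"
    if x: "x \<in> Abstract_Topology.closure_of (norm_topology V) U" for a x
  proof -
    have xC: "x \<in> \<C>"
      using x cl by auto
    have "\<exists>u\<in>U. \<parallel>a \<boxdot> x \<boxplus> (- 1) \<boxdot> u\<parallel> < r" if "0 < r" for r
    proof -
      \<comment> \<open>The summand \<open>1\<close> covers the case \<open>a = 0\<close>.\<close>
      have "0 < r / (cmod a + 1)"
        using \<open>0 < r\<close> by (simp add: add_nonneg_pos)
      then obtain u where u: "u \<in> U" "\<parallel>x \<boxplus> (- 1) \<boxdot> u\<parallel> < r / (cmod a + 1)"
        using x unfolding cl by blast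
      then have uC: "u \<in> \<C>"
        using D(1) by auto
      have "a \<boxdot> x \<boxplus> (- 1) \<boxdot> (a \<boxdot> u) = a \<boxdot> (x \<boxplus> (- 1) \<boxdot> u)"
        using xC uC by (simp add: scale_add_right)
      then have "\<parallel>a \<boxdot> x \<boxplus> (- 1) \<boxdot> (a \<boxdot> u)\<parallel> = cmod a * \<parallel>x \<boxplus> (- 1) \<boxdot> u\<parallel>"
        using xC uC by (simp add: norm_scale)
      also have "\<dots> \<le> (cmod a + 1) * \<parallel>x \<boxplus> (- 1) \<boxdot> u\<parallel>"
        using xC uC by (intro mult_right_mono) auto
      also have "\<dots> < r"
        using u(2) by (simp add: pos_less_divide_eq add_nonneg_pos mult.commute)
      finally show ?thesis
        using D(3) u by blast
    qed
    then show ?thesis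
      using xC by (simp add: cl)
  qed
  moreover have "Abstract_Topology.closure_of (norm_topology V) U \<noteq> {}"
    using closure_of_subset[of U "norm_topology V"] D(1,4) by auto
  moreover have "Abstract_Topology.closure_of (norm_topology V) U \<subseteq> \<C>"
    using cl by auto
  ultimately show ?thesis
    unfolding vsubspace_def by blast
qed

lemma subspace_complex_normed_space:
  assumes "vsubspace V U"
  shows "complex_normed_space (V\<lparr>vcarrier := U\<rparr>)"
proof -
  note D = vsubspaceD[OF assms]
  have [simp]: "x \<in> \<C>" if "x \<in> U" for x
    using that D(1) by auto
  show ?thesis
    by unfold_locales
      (use D in \<open>auto simp: add_assoc scale_add_left scale_add_right norm_triangle norm_scale
          norm_eq_zero intro: add_commute\<close>)
qed

end

lemma linear_map_zero:
  assumes "complex_normed_space V" "complex_normed_space W" "linear_map V W T"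
  shows "T (complex_normed_space.zero V) = complex_normed_space.zero W"
proof -
  interpret V: complex_normed_space V by fact
  interpret W: complex_normed_space W by fact
  have "T (vscale V 0 V.zero) = vscale W 0 (T V.zero)" "T V.zero \<in> vcarrier W"
    using assms(3) V.zero_closed unfolding linear_map_def by blast+
  then show ?thesis
    by simp
qed

subsection \<open>Operator norm and dual space\<close>

lemma bdd_above_opnorm:
  assumes "complex_normed_space V" "bounded_linear_map V W T"
  shows "bdd_above ((\<lambda>x. vnorm W (T x)) ` {x \<in> vcarrier V. vnorm V x \<le> 1})"
proof -
  interpret V: complex_normed_space V by fact
  obtain C where C: "\<forall>x\<in>vcarrier V. vnorm W (T x) \<le> C * vnorm V x"
    using assms(2) by (auto simp: bounded_linear_map_def)
  have "vnorm W (T x) \<le> \<bar>C\<bar>" if "x \<in> vcarrier V" "vnorm V x \<le> 1" for x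
  proof -
    have "vnorm W (T x) \<le> \<bar>C\<bar> * vnorm V x"
      using C that by (meson V.norm_nonneg abs_ge_self mult_right_mono order_trans)
    also have "\<dots> \<le> \<bar>C\<bar> * 1"
      using that by (intro mult_left_mono) auto
    finally show ?thesis by simp
  qed
  then show ?thesis
    by (auto simp: bdd_above_def)
qed

text \<open>The supremum in \<open>opnorm\<close> is meaningful only for bounded maps; the next lemmas are the
  interface through which it is used.\<close>

lemma opnorm_bound_unit:
  assumes "complex_normed_space V" "bounded_linear_map V W T" "x \<in> vcarrier V" "vnorm V x \<le> 1"
  shows "vnorm W (T x) \<le> opnorm V W T"
  unfolding opnorm_def by (rule cSUP_upper[OF _ bdd_above_opnorm[OF assms(1,2)]]) (use assms in auto)

lemma opnorm_le:
  assumes "complex_normed_space V"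
    and "\<And>x. \<lbrakk>x \<in> vcarrier V; vnorm V x \<le> 1\<rbrakk> \<Longrightarrow> vnorm W (T x) \<le> C"
  shows "opnorm V W T \<le> C"
proof -
  interpret V: complex_normed_space V by fact
  have "V.zero \<in> {x \<in> vcarrier V. vnorm V x \<le> 1}"
    by simp
  then have "{x \<in> vcarrier V. vnorm V x \<le> 1} \<noteq> {}"
    by blast
  then show ?thesis
    unfolding opnorm_def by (rule cSUP_least) (use assms in auto)
qed

lemma opnorm_nonneg:
  assumes "complex_normed_space V" "complex_normed_space W" "bounded_linear_map V W T"
  shows "0 \<le> opnorm V W T"
proof -
  interpret V: complex_normed_space V by fact
  interpret W: complex_normed_space W by fact
  have "vnorm W (T V.zero) = 0"
    using linear_map_zero[OF assms(1,2), of T] assms(3) by (simp add: bounded_linear_map_def)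
  then show ?thesis
    using opnorm_bound_unit[OF assms(1,3), of V.zero] by simp
qed

lemma opnorm_bound:
  assumes "complex_normed_space V" "complex_normed_space W" "bounded_linear_map V W T"
    and "x \<in> vcarrier V"
  shows "vnorm W (T x) \<le> opnorm V W T * vnorm V x"
proof -
  interpret V: complex_normed_space V by fact
  interpret W: complex_normed_space W by fact
  have lin: "linear_map V W T"
    using assms(3) by (simp add: bounded_linear_map_def)
  then have Tx: "T x \<in> vcarrier W"
    using assms(4) by (auto simp: linear_map_def)
  show ?thesis
  proof (cases "x = V.zero")
    case True
    then show ?thesis
      using linear_map_zero[OF assms(1,2) lin] by simp
  next
    case False
    define c where "c = vnorm V x"
    have c: "0 < c"
      using False assms(4) V.norm_eq_zero[of x] V.norm_nonneg[of x] by (simp add: c_def less_le)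
    have "vnorm W (T (vscale V (complex_of_real (1 / c)) x)) \<le> opnorm V W T"
      by (rule opnorm_bound_unit[OF assms(1,3)])
        (use assms(4) c in \<open>simp_all add: V.norm_scale norm_divide flip: c_def\<close>)
    moreover have "T (vscale V (complex_of_real (1 / c)) x) = vscale W (complex_of_real (1 / c)) (T x)"
      using lin assms(4) by (simp add: linear_map_def)
    ultimately have "vnorm W (T x) / c \<le> opnorm V W T"
      using Tx c by (simp add: W.norm_scale norm_divide)
    then show ?thesis
      using c by (simp add: divide_le_eq flip: c_def)
  qed
qed

lemma bounded_linear_mapI:
  assumes "linear_map V W T" "\<And>x. x \<in> vcarrier V \<Longrightarrow> vnorm W (T x) \<le> C * vnorm V x"
  shows "bounded_linear_map V W T"
  using assms by (auto simp: bounded_linear_map_def)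

lemma complex_normed_space_complex_field: "complex_normed_space complex_field_space"
  by unfold_locales (auto simp: complex_field_space_def algebra_simps norm_triangle_ineq norm_mult)

lemma linear_functional_iff:
  "linear_map V complex_field_space f \<longleftrightarrow>
     (\<forall>x\<in>vcarrier V. \<forall>y\<in>vcarrier V. f (vadd V x y) = f x + f y) \<and>
     (\<forall>a. \<forall>x\<in>vcarrier V. f (vscale V a x) = a * f x)"
  by (auto simp: linear_map_def complex_field_space_def)

lemma dual_space_sel [simp]:
  "vadd (dual_space V) \<phi> \<psi> = (\<lambda>x\<in>vcarrier V. \<phi> x + \<psi> x)"
  "vscale (dual_space V) a \<phi> = (\<lambda>x\<in>vcarrier V. a * \<phi> x)"
  by (simp_all add: dual_space_def)

lemma mem_dual_space:
  "\<phi> \<in> vcarrier (dual_space V) \<longleftrightarrow> \<phi> \<in> extensional (vcarrier V) \<and>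
     linear_map V complex_field_space \<phi> \<and> (\<exists>C. \<forall>x\<in>vcarrier V. cmod (\<phi> x) \<le> C * vnorm V x)"
  by (simp add: dual_space_def bounded_linear_map_def) (simp add: complex_field_space_def)

lemma dual_spaceD:
  assumes "\<phi> \<in> vcarrier (dual_space V)"
  shows "\<phi> \<in> extensional (vcarrier V)"
    "\<lbrakk>x \<in> vcarrier V; y \<in> vcarrier V\<rbrakk> \<Longrightarrow> \<phi> (vadd V x y) = \<phi> x + \<phi> y"
    "x \<in> vcarrier V \<Longrightarrow> \<phi> (vscale V a x) = a * \<phi> x"
  using assms by (auto simp: mem_dual_space linear_functional_iff)

lemma dual_space_bound:
  assumes "complex_normed_space V" "\<phi> \<in> vcarrier (dual_space V)" "x \<in> vcarrier V"
  shows "cmod (\<phi> x) \<le> vnorm (dual_space V) \<phi> * vnorm V x"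
  using opnorm_bound[OF assms(1) complex_normed_space_complex_field, of \<phi> x] assms(2,3)
  by (simp add: dual_space_def) (simp add: complex_field_space_def)

lemma dual_norm_le:
  assumes "complex_normed_space V"
    and "\<And>x. \<lbrakk>x \<in> vcarrier V; vnorm V x \<le> 1\<rbrakk> \<Longrightarrow> cmod (\<phi> x) \<le> C"
  shows "vnorm (dual_space V) \<phi> \<le> C"
  using opnorm_le[OF assms(1), of complex_field_space \<phi> C] assms(2)
  by (simp add: dual_space_def) (simp add: complex_field_space_def)

lemma dual_norm_nonneg:
  assumes "complex_normed_space V" "\<phi> \<in> vcarrier (dual_space V)"
  shows "0 \<le> vnorm (dual_space V) \<phi>"
  using opnorm_nonneg[OF assms(1) complex_normed_space_complex_field, of \<phi>] assms(2)
  by (simp add: dual_space_def)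

lemma dual_space_complex_normed_space:
  assumes "complex_normed_space V"
  shows "complex_normed_space (dual_space V)"
proof -
  interpret V: complex_normed_space V by fact
  let ?D = "dual_space V"
  note bound = dual_space_bound[OF assms]
  have scaled: "cmod (a * \<phi> x) \<le> (cmod a * vnorm ?D \<phi>) * vnorm V x"
    if "\<phi> \<in> vcarrier ?D" "x \<in> vcarrier V" for a \<phi> x
    using mult_left_mono[OF bound[OF that], of "cmod a"] by (simp add: norm_mult mult.assoc)
  have summed: "cmod (\<phi> x + \<psi> x) \<le> (vnorm ?D \<phi> + vnorm ?D \<psi>) * vnorm V x"
    if "\<phi> \<in> vcarrier ?D" "\<psi> \<in> vcarrier ?D" "x \<in> vcarrier V" for \<phi> \<psi> x
    using norm_triangle_ineq[of "\<phi> x" "\<psi> x"] bound[OF that(1,3)] bound[OF that(2,3)]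
    by (simp add: distrib_right)
  have scale_closed: "vscale ?D a \<phi> \<in> vcarrier ?D" if "\<phi> \<in> vcarrier ?D" for a \<phi>
    using scaled[OF that, of _ a] that unfolding mem_dual_space linear_functional_iff
    by (auto simp: algebra_simps intro!: exI[of _ "cmod a * vnorm ?D \<phi>"])
  have scale_le: "vnorm ?D (vscale ?D a \<phi>) \<le> cmod a * vnorm ?D \<phi>" if "\<phi> \<in> vcarrier ?D" for a \<phi>
  proof (rule dual_norm_le[OF assms])
    fix x assume x: "x \<in> vcarrier V" "vnorm V x \<le> 1"
    have "(cmod a * vnorm ?D \<phi>) * vnorm V x \<le> cmod a * vnorm ?D \<phi>"
      using x dual_norm_nonneg[OF assms that] by (simp add: mult_left_le)
    then show "cmod (vscale ?D a \<phi> x) \<le> cmod a * vnorm ?D \<phi>"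
      using scaled[OF that x(1), of a] x(1) by simp
  qed
  have scale_one: "vscale ?D 1 \<phi> = \<phi>" if "\<phi> \<in> vcarrier ?D" for \<phi>
    using dual_spaceD(1)[OF that] by (auto simp: extensional_def)
  show ?thesis
  proof
    fix \<phi> \<psi> assume \<phi>: "\<phi> \<in> vcarrier ?D" and \<psi>: "\<psi> \<in> vcarrier ?D"
    show "vadd ?D \<phi> \<psi> \<in> vcarrier ?D"
      using summed[OF \<phi> \<psi>] \<phi> \<psi> unfolding mem_dual_space linear_functional_iff
      by (auto simp: algebra_simps intro!: exI[of _ "vnorm ?D \<phi> + vnorm ?D \<psi>"])
    show "vnorm ?D (vadd ?D \<phi> \<psi>) \<le> vnorm ?D \<phi> + vnorm ?D \<psi>"
    proof (rule dual_norm_le[OF assms])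
      fix x assume x: "x \<in> vcarrier V" "vnorm V x \<le> 1"
      have "(vnorm ?D \<phi> + vnorm ?D \<psi>) * vnorm V x \<le> vnorm ?D \<phi> + vnorm ?D \<psi>"
        using x dual_norm_nonneg[OF assms \<phi>] dual_norm_nonneg[OF assms \<psi>] by (simp add: mult_left_le)
      then show "cmod (vadd ?D \<phi> \<psi> x) \<le> vnorm ?D \<phi> + vnorm ?D \<psi>"
        using summed[OF \<phi> \<psi> x(1)] x(1) by simp
    qed
  next
    fix \<phi> a assume \<phi>: "\<phi> \<in> vcarrier ?D"
    show "vscale ?D a \<phi> \<in> vcarrier ?D"
      by (rule scale_closed[OF \<phi>])
    show "vnorm ?D (vscale ?D a \<phi>) = cmod a * vnorm ?D \<phi>"
    proof (cases "a = 0")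
      case True
      then show ?thesis
        using scale_le[OF \<phi>, of 0] dual_norm_nonneg[OF assms scale_closed[OF \<phi>, of 0]] by simp
    next
      case False
      have "vscale ?D (1 / a) (vscale ?D a \<phi>) = vscale ?D 1 \<phi>"
        using False by (auto simp: fun_eq_iff)
      then have "vnorm ?D \<phi> \<le> cmod (1 / a) * vnorm ?D (vscale ?D a \<phi>)"
        using scale_le[OF scale_closed[OF \<phi>], of "1 / a" a] scale_one[OF \<phi>] by simp
      then show ?thesis
        using scale_le[OF \<phi>, of a] False by (simp add: norm_divide field_simps)
    qed
  next
    fix \<phi> assume \<phi>: "\<phi> \<in> vcarrier ?D" "vnorm ?D \<phi> = 0"
    have "\<phi> x = 0" if "x \<in> vcarrier V" for x
      using bound[OF \<phi>(1) that] \<phi>(2) by simp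
    then show "vscale ?D 0 \<phi> = \<phi>"
      using dual_spaceD(1)[OF \<phi>(1)] by (auto simp: extensional_def)
  next
    have "(\<lambda>x\<in>vcarrier V. 0) \<in> vcarrier ?D"
      by (auto simp: mem_dual_space linear_functional_iff intro!: exI[of _ 0])
    then show "\<exists>z\<in>vcarrier ?D. \<forall>\<phi>\<in>vcarrier ?D. vscale ?D 0 \<phi> = z"
      by (intro bexI[of _ "\<lambda>x\<in>vcarrier V. 0"]) auto
  next
    fix \<phi> assume "\<phi> \<in> vcarrier ?D"
    then show "vscale ?D 1 \<phi> = \<phi>"
      by (rule scale_one)
  qed (auto simp: fun_eq_iff algebra_simps)
qed

section \<open>The Hahn-Banach theorem by minimal sublinear functionals\<close>

context complex_normed_space
begin

definition sublinear :: "('a \<Rightarrow> real) \<Rightarrow> bool" where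
  "sublinear q \<longleftrightarrow> (\<forall>x\<in>\<C>. \<forall>y\<in>\<C>. q (x \<boxplus> y) \<le> q x + q y) \<and>
     (\<forall>t\<ge>0. \<forall>x\<in>\<C>. q (complex_of_real t \<boxdot> x) = t * q x)"

lemma sublinearD:
  assumes "sublinear q"
  shows "\<lbrakk>x \<in> \<C>; y \<in> \<C>\<rbrakk> \<Longrightarrow> q (x \<boxplus> y) \<le> q x + q y"
    and "\<lbrakk>0 \<le> t; x \<in> \<C>\<rbrakk> \<Longrightarrow> q (complex_of_real t \<boxdot> x) = t * q x"
    and "q \<zero>\<^sub>V = 0"
    and "x \<in> \<C> \<Longrightarrow> - q ((- 1) \<boxdot> x) \<le> q x"
proof -
  have add: "\<lbrakk>x \<in> \<C>; y \<in> \<C>\<rbrakk> \<Longrightarrow> q (x \<boxplus> y) \<le> q x + q y"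
    and scale: "\<lbrakk>0 \<le> t; x \<in> \<C>\<rbrakk> \<Longrightarrow> q (complex_of_real t \<boxdot> x) = t * q x" for x y t
    using assms by (auto simp: sublinear_def)
  show "\<lbrakk>x \<in> \<C>; y \<in> \<C>\<rbrakk> \<Longrightarrow> q (x \<boxplus> y) \<le> q x + q y"
    and "\<lbrakk>0 \<le> t; x \<in> \<C>\<rbrakk> \<Longrightarrow> q (complex_of_real t \<boxdot> x) = t * q x"
    by (fact add, fact scale)
  show zero: "q \<zero>\<^sub>V = 0"
    using scale[of 0 "\<zero>\<^sub>V"] by simp
  show "x \<in> \<C> \<Longrightarrow> - q ((- 1) \<boxdot> x) \<le> q x"
    using add[of x "(- 1) \<boxdot> x"] zero by simp
qed

lemma sublinear_cong:
  assumes "\<And>x. x \<in> \<C> \<Longrightarrow> q x = r x"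
  shows "sublinear q \<longleftrightarrow> sublinear r"
  unfolding sublinear_def using assms by auto

text \<open>
  Lowering \<open>q\<close> in the direction \<open>y\<close>: the largest sublinear functional \<open>r \<le> q\<close> with
  \<open>r (- y) \<le> - q y\<close>. It drives the whole argument, because a minimal \<open>q\<close> cannot be lowered
  any more.
\<close>

definition lower :: "'a \<Rightarrow> ('a \<Rightarrow> real) \<Rightarrow> 'a \<Rightarrow> real" where
  "lower y q x = (INF t\<in>{0..}. q (x \<boxplus> complex_of_real t \<boxdot> y) - t * q y)"

context
  fixes q y
  assumes q: "sublinear q" and y: "y \<in> \<C>"
begin

lemma lower_bdd_below:
  assumes "x \<in> \<C>"
  shows "bdd_below ((\<lambda>t. q (x \<boxplus> complex_of_real t \<boxdot> y) - t * q y) ` {0..})"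
proof (rule bdd_belowI2)
  fix t :: real assume "t \<in> {0..}"
  have "(x \<boxplus> complex_of_real t \<boxdot> y) \<boxplus> (- 1) \<boxdot> x = complex_of_real t \<boxdot> y"
    using assms y by (simp add: add_commute[of x])
  then have "t * q y \<le> q (x \<boxplus> complex_of_real t \<boxdot> y) + q ((- 1) \<boxdot> x)"
    using sublinearD(1)[OF q, of "x \<boxplus> complex_of_real t \<boxdot> y" "(- 1) \<boxdot> x"]
      sublinearD(2)[OF q, of t y] assms y \<open>t \<in> {0..}\<close> by simp
  then show "- q ((- 1) \<boxdot> x) \<le> q (x \<boxplus> complex_of_real t \<boxdot> y) - t * q y"
    by simp
qed

lemma lower_le_at:
  assumes "x \<in> \<C>" "0 \<le> t"
  shows "lower y q x \<le> q (x \<boxplus> complex_of_real t \<boxdot> y) - t * q y"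
  unfolding lower_def using lower_bdd_below[OF assms(1)] assms(2) by (intro cINF_lower) auto

lemma lower_greatest:
  assumes "\<And>t. 0 \<le> t \<Longrightarrow> c \<le> q (x \<boxplus> complex_of_real t \<boxdot> y) - t * q y"
  shows "c \<le> lower y q x"
  unfolding lower_def using assms by (intro cINF_greatest) auto

lemma lower_le: "x \<in> \<C> \<Longrightarrow> lower y q x \<le> q x"
  using lower_le_at[of x 0] y by simp

lemma lower_minus: "lower y q ((- 1) \<boxdot> y) \<le> - q y"
  using lower_le_at[of "(- 1) \<boxdot> y" 1] y sublinearD(3)[OF q] by simp

lemma sublinear_lower: "sublinear (lower y q)"
proof -
  have add: "lower y q (u \<boxplus> v) \<le> lower y q u + lower y q v" if "u \<in> \<C>" "v \<in> \<C>" for u v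
  proof -
    have "lower y q (u \<boxplus> v) \<le> (q (u \<boxplus> complex_of_real s \<boxdot> y) - s * q y) +
        (q (v \<boxplus> complex_of_real t \<boxdot> y) - t * q y)" if "0 \<le> s" "0 \<le> t" for s t
    proof -
      have "(u \<boxplus> v) \<boxplus> complex_of_real (s + t) \<boxdot> y =
          (u \<boxplus> complex_of_real s \<boxdot> y) \<boxplus> (v \<boxplus> complex_of_real t \<boxdot> y)"
        using \<open>u \<in> \<C>\<close> \<open>v \<in> \<C>\<close> y by (simp add: scale_add_left add_ac)
      then show ?thesis
        using lower_le_at[of "u \<boxplus> v" "s + t"] \<open>u \<in> \<C>\<close> \<open>v \<in> \<C>\<close> y that
          sublinearD(1)[OF q, of "u \<boxplus> complex_of_real s \<boxdot> y" "v \<boxplus> complex_of_real t \<boxdot> y"]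
        by (simp add: algebra_simps)
    qed
    then have "lower y q (u \<boxplus> v) - (q (v \<boxplus> complex_of_real t \<boxdot> y) - t * q y) \<le> lower y q u"
      if "0 \<le> t" for t
      using that by (intro lower_greatest) (simp add: algebra_simps)
    then have "lower y q (u \<boxplus> v) - lower y q u \<le> lower y q v"
      by (intro lower_greatest) (simp add: algebra_simps)
    then show ?thesis by simp
  qed
  have half: "c * lower y q u \<le> lower y q (complex_of_real c \<boxdot> u)" if "0 < c" "u \<in> \<C>" for c u
  proof (rule lower_greatest)
    fix t :: real assume "0 \<le> t"
    have "complex_of_real c \<boxdot> u \<boxplus> complex_of_real t \<boxdot> y =
        complex_of_real c \<boxdot> (u \<boxplus> complex_of_real (t / c) \<boxdot> y)"
      using that y by (simp add: scale_add_right)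
    then have "q (complex_of_real c \<boxdot> u \<boxplus> complex_of_real t \<boxdot> y) - t * q y =
        c * (q (u \<boxplus> complex_of_real (t / c) \<boxdot> y) - t / c * q y)"
      using sublinearD(2)[OF q, of c "u \<boxplus> complex_of_real (t / c) \<boxdot> y"] that y
      by (simp add: algebra_simps)
    moreover have "c * lower y q u \<le> c * (q (u \<boxplus> complex_of_real (t / c) \<boxdot> y) - t / c * q y)"
      using lower_le_at[of u "t / c"] that \<open>0 \<le> t\<close> by (intro mult_left_mono) auto
    ultimately show "c * lower y q u \<le> q (complex_of_real c \<boxdot> u \<boxplus> complex_of_real t \<boxdot> y) - t * q y"
      by simp
  qed
  have "lower y q (complex_of_real c \<boxdot> u) = c * lower y q u" if "0 \<le> c" "u \<in> \<C>" for c u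
  proof (cases "c = 0")
    case True
    have "lower y q \<zero>\<^sub>V = 0"
      unfolding lower_def using y sublinearD(2)[OF q] by (simp add: image_constant_conv)
    then show ?thesis
      using True that by simp
  next
    case False
    have "1 / c * lower y q (complex_of_real c \<boxdot> u) \<le> lower y q u"
      using half[of "1 / c" "complex_of_real c \<boxdot> u"] that False by simp
    then have "lower y q (complex_of_real c \<boxdot> u) \<le> c * lower y q u"
      using that False by (simp add: field_simps)
    then show ?thesis
      using half[of c u] that False by simp
  qed
  then show ?thesis
    using add by (simp add: sublinear_def)
qed

end

text \<open>
  Lowering a minimal \<open>q\<close> in the direction \<open>y\<close> does not change it, so \<open>q x\<close> is a lower bound of
  \<open>q (x + t y) - t q y\<close>; the case \<open>t = 1\<close> is the missing half of additivity.
\<close>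

lemma minimal_sublinear_additive:
  assumes "sublinear q"
    and minimal: "\<forall>r. sublinear r \<longrightarrow> (\<forall>x\<in>\<C>. r x \<le> q x) \<longrightarrow> (\<forall>x\<in>\<C>. r x = q x)"
    and xy: "x \<in> \<C>" "y \<in> \<C>"
  shows "q (x \<boxplus> y) = q x + q y"
proof -
  have "lower y q x = q x"
    using minimal sublinear_lower[OF assms(1) xy(2)] lower_le[OF assms(1) xy(2)] xy by blast
  then have "q x \<le> q (x \<boxplus> y) - q y"
    using lower_le_at[OF assms(1) xy(2,1), of 1] xy by simp
  then show ?thesis
    using sublinearD(1)[OF assms(1) xy] by simp
qed

text \<open>
  By Zorn's lemma it is enough that the pointwise infimum of a chain of sublinear functionals is
  sublinear: if \<open>q\<close> and \<open>r\<close> belong to the chain, then the smaller one, applied to \<open>x + y\<close>, is at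
  most \<open>q x + r y\<close>. The infimum is finite because \<open>q x \<ge> - q (- x) \<ge> - p (- x)\<close>.
\<close>

lemma exists_minimal_sublinear:
  assumes "sublinear p"
  shows "\<exists>q. sublinear q \<and> (\<forall>x\<in>\<C>. q x \<le> p x) \<and>
    (\<forall>r. sublinear r \<longrightarrow> (\<forall>x\<in>\<C>. r x \<le> q x) \<longrightarrow> (\<forall>x\<in>\<C>. r x = q x))"
proof -
  define A where "A = {q \<in> extensional \<C>. sublinear q \<and> (\<forall>x\<in>\<C>. q x \<le> p x)}"
  \<comment> \<open>The order is reversed, so that the maximal elements of Zorn's lemma are the minimal
    functionals.\<close>
  define P where "P q r \<longleftrightarrow> (\<forall>x\<in>\<C>. r x \<le> q x)" for q r :: "'a \<Rightarrow> real"
  have restrict_A: "restrict r \<C> \<in> A" if "sublinear r" "\<And>x. x \<in> \<C> \<Longrightarrow> r x \<le> p x" for r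
    unfolding A_def using that sublinear_cong[of "restrict r \<C>" r] by simp
  have po: "partial_order_on A (relation_of P A)"
  proof (rule partial_order_on_relation_ofI)
    fix q r s assume "q \<in> A" "r \<in> A" "s \<in> A"
    show "P q q"
      by (simp add: P_def)
    show "P q r \<Longrightarrow> P r s \<Longrightarrow> P q s"
      by (force simp: P_def)
    show "P q r \<Longrightarrow> P r q \<Longrightarrow> q = r"
      using \<open>q \<in> A\<close> \<open>r \<in> A\<close> unfolding P_def A_def
      by (intro extensionalityI[of q \<C> r]) (auto intro: order_antisym)
  qed
  have ch: "\<exists>u\<in>A. \<forall>a\<in>K. P a u" if "K \<in> Chains (relation_of P A)" for K
  proof (cases "K = {}")
    case True
    then show ?thesis
      using restrict_A[OF assms] by auto
  next
    case False
    have KA: "K \<subseteq> A" and total: "\<And>q r. \<lbrakk>q \<in> K; r \<in> K\<rbrakk> \<Longrightarrow> P q r \<or> P r q"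
      using that by (auto simp: Chains_def relation_of_def)
    have sub: "sublinear q" if "q \<in> K" for q
      using that KA by (auto simp: A_def)
    have low: "- p ((- 1) \<boxdot> x) \<le> q x" if "q \<in> K" "x \<in> \<C>" for q x
    proof -
      have "q ((- 1) \<boxdot> x) \<le> p ((- 1) \<boxdot> x)"
        using that KA by (auto simp: A_def)
      then show ?thesis
        using sublinearD(4)[OF sub[OF that(1)] that(2)] by linarith
    qed
    have bdd: "bdd_below ((\<lambda>q. q x) ` K)" if "x \<in> \<C>" for x
      by (rule bdd_belowI2[where m = "- p ((- 1) \<boxdot> x)"]) (use low that in auto)
    define u where "u x = (INF q\<in>K. q x)" for x
    have u_le: "u x \<le> q x" if "q \<in> K" "x \<in> \<C>" for q x
      unfolding u_def by (rule cINF_lower[OF bdd]) (use that in auto)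
    have u_greatest: "c \<le> u x" if "\<And>q. q \<in> K \<Longrightarrow> c \<le> q x" for c x
      unfolding u_def by (rule cINF_greatest) (use False that in auto)
    have "u (x \<boxplus> y) \<le> u x + u y" if xy: "x \<in> \<C>" "y \<in> \<C>" for x y
    proof -
      have "u (x \<boxplus> y) \<le> q x + r y" if "q \<in> K" "r \<in> K" for q r
      proof (cases "P q r")
        case True
        then have "r x \<le> q x"
          using xy by (simp add: P_def)
        then show ?thesis
          using u_le[OF \<open>r \<in> K\<close>, of "x \<boxplus> y"] sublinearD(1)[OF sub[OF \<open>r \<in> K\<close>] xy] xy by simp
      next
        case False
        then have "q y \<le> r y"
          using xy total[OF that] by (auto simp: P_def)
        then show ?thesis
          using u_le[OF \<open>q \<in> K\<close>, of "x \<boxplus> y"] sublinearD(1)[OF sub[OF \<open>q \<in> K\<close>] xy] xy by simp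
      qed
      then have "u (x \<boxplus> y) - r y \<le> u x" if "r \<in> K" for r
        using that by (intro u_greatest) (simp add: algebra_simps)
      then have "u (x \<boxplus> y) - u x \<le> u y"
        by (intro u_greatest) (simp add: algebra_simps)
      then show ?thesis by simp
    qed
    moreover have "u (complex_of_real t \<boxdot> x) = t * u x" if t: "0 \<le> t" and x: "x \<in> \<C>" for t x
    proof (cases "t = 0")
      case True
      obtain q where "q \<in> K"
        using False by auto
      then have "u \<zero>\<^sub>V \<le> 0"
        using u_le[of q "\<zero>\<^sub>V"] sublinearD(3)[OF sub[of q]] by simp
      moreover have "0 \<le> u \<zero>\<^sub>V"
      proof (rule u_greatest)
        fix q assume "q \<in> K"
        then show "0 \<le> q \<zero>\<^sub>V"
          using sublinearD(3)[OF sub[of q]] by simp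
      qed
      ultimately have "u \<zero>\<^sub>V = 0"
        by simp
      then show ?thesis
        using True x by simp
    next
      case t0: False
      have scale: "q (complex_of_real t \<boxdot> x) = t * q x" if "q \<in> K" for q
        using sublinearD(2)[OF sub[OF that] t x] .
      have "u (complex_of_real t \<boxdot> x) / t \<le> u x"
      proof (rule u_greatest)
        fix q assume "q \<in> K"
        then show "u (complex_of_real t \<boxdot> x) / t \<le> q x"
          using u_le[of q "complex_of_real t \<boxdot> x"] scale[of q] x t t0 by (simp add: field_simps)
      qed
      moreover have "t * u x \<le> u (complex_of_real t \<boxdot> x)"
      proof (rule u_greatest)
        fix q assume "q \<in> K"
        then show "t * u x \<le> q (complex_of_real t \<boxdot> x)"
          using u_le[of q x] scale[of q] x t by (simp add: mult_left_mono)
      qed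
      ultimately show ?thesis
        using t t0 by (simp add: field_simps)
    qed
    ultimately have "sublinear u"
      by (simp add: sublinear_def)
    moreover have "u x \<le> p x" if "x \<in> \<C>" for x
    proof -
      obtain q where "q \<in> K"
        using False by auto
      then have "q x \<le> p x"
        using KA that by (auto simp: A_def)
      then show ?thesis
        using u_le[OF \<open>q \<in> K\<close> that] by simp
    qed
    ultimately have "restrict u \<C> \<in> A"
      by (rule restrict_A)
    then show ?thesis
      by (rule bexI[rotated]) (use u_le in \<open>simp add: P_def\<close>)
  qed
  obtain q where q: "q \<in> A" and min: "\<And>r. \<lbrakk>r \<in> A; P q r\<rbrakk> \<Longrightarrow> r = q"
    using predicate_Zorn[OF po ch] by blast
  show ?thesis
  proof (intro exI conjI allI impI ballI)
    show "sublinear q" and le: "\<And>x. x \<in> \<C> \<Longrightarrow> q x \<le> p x"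
      using q by (auto simp: A_def)
    fix r x assume r: "sublinear r" "\<forall>x\<in>\<C>. r x \<le> q x" and x: "x \<in> \<C>"
    have "restrict r \<C> = q"
    proof (rule min)
      show "restrict r \<C> \<in> A"
        using r le by (intro restrict_A) (blast intro: order_trans)+
    qed (use r(2) in \<open>simp add: P_def\<close>)
    then show "r x = q x"
      using x by (metis restrict_apply')
  qed
qed

text \<open>
  The distance to \<open>U\<close> is sublinear and vanishes on \<open>U\<close>; lowered in the direction \<open>x\<close>, it forces
  every minimal functional below it to be nonzero at \<open>x\<close>. Such a functional is real linear, and
  its complexification \<open>q z - \<i> q (\<i> z)\<close> is the required one.
\<close>

theorem separating_functional:
  assumes U: "vsubspace V U" "closedin (norm_topology V) U" and x: "x \<in> \<C>" "x \<notin> U"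
  obtains f where "f \<in> vcarrier (dual_space V)" "\<And>u. u \<in> U \<Longrightarrow> f u = 0" "f x \<noteq> 0"
proof -
  note D = vsubspaceD[OF U(1)]
  have [simp]: "u \<in> \<C>" if "u \<in> U" for u
    using D(1) that by auto
  \<comment> \<open>The distance from \<open>z\<close> to \<open>U\<close>, since \<open>U = - U\<close>.\<close>
  define p where "p z = (INF u\<in>U. \<parallel>z \<boxplus> u\<parallel>)" for z
  have p_le: "p z \<le> \<parallel>z \<boxplus> u\<parallel>" if "z \<in> \<C>" "u \<in> U" for z u
    unfolding p_def by (rule cINF_lower) (use that in \<open>auto intro!: bdd_belowI2[where m = 0]\<close>)
  have p_greatest: "c \<le> p z" if "\<And>u. u \<in> U \<Longrightarrow> c \<le> \<parallel>z \<boxplus> u\<parallel>" for c z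
    unfolding p_def by (rule cINF_greatest) (use D(4) that in auto)
  have "sublinear p"
    unfolding sublinear_def
  proof (intro conjI ballI allI impI)
    fix y z assume yz: "y \<in> \<C>" "z \<in> \<C>"
    have "p (y \<boxplus> z) \<le> \<parallel>y \<boxplus> u\<parallel> + \<parallel>z \<boxplus> v\<parallel>" if "u \<in> U" "v \<in> U" for u v
    proof -
      have "(y \<boxplus> z) \<boxplus> (u \<boxplus> v) = (y \<boxplus> u) \<boxplus> (z \<boxplus> v)"
        using yz that by (simp add: add_ac)
      then show ?thesis
        using p_le[of "y \<boxplus> z" "u \<boxplus> v"] norm_triangle[of "y \<boxplus> u" "z \<boxplus> v"] yz that D(2) by simp
    qed
    then have "p (y \<boxplus> z) - \<parallel>z \<boxplus> v\<parallel> \<le> p y" if "v \<in> U" for v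
      using that by (intro p_greatest) (simp add: algebra_simps)
    then have "p (y \<boxplus> z) - p y \<le> p z"
      by (intro p_greatest) (simp add: algebra_simps)
    then show "p (y \<boxplus> z) \<le> p y + p z"
      by simp
  next
    fix t :: real and z assume t: "0 \<le> t" and z: "z \<in> \<C>"
    have scale: "\<parallel>complex_of_real t \<boxdot> z \<boxplus> complex_of_real t \<boxdot> u\<parallel> = t * \<parallel>z \<boxplus> u\<parallel>" if "u \<in> U" for u
      using that z t by (simp add: norm_scale flip: scale_add_right)
    show "p (complex_of_real t \<boxdot> z) = t * p z"
    proof (cases "t = 0")
      case True
      have "p \<zero>\<^sub>V = 0"
        using p_le[OF zero_closed D(4)] by (intro order_antisym p_greatest) auto
      then show ?thesis
        using True z by simp
    next
      case False
      have "p (complex_of_real t \<boxdot> z) / t \<le> p z"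
      proof (rule p_greatest)
        fix u assume u: "u \<in> U"
        show "p (complex_of_real t \<boxdot> z) / t \<le> \<parallel>z \<boxplus> u\<parallel>"
          using p_le[of "complex_of_real t \<boxdot> z" "complex_of_real t \<boxdot> u"] scale[OF u] z u D(3) t False
          by (simp add: field_simps)
      qed
      moreover have "t * p z \<le> p (complex_of_real t \<boxdot> z)"
      proof (rule p_greatest)
        fix u assume u: "u \<in> U"
        let ?v = "complex_of_real (1 / t) \<boxdot> u"
        have v: "?v \<in> U" and "complex_of_real t \<boxdot> ?v = u"
          using u D(3) False by auto
        then have "\<parallel>complex_of_real t \<boxdot> z \<boxplus> u\<parallel> = t * \<parallel>z \<boxplus> ?v\<parallel>"
          using scale[OF v] by simp
        then show "t * p z \<le> \<parallel>complex_of_real t \<boxdot> z \<boxplus> u\<parallel>"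
          using p_le[OF z v] t by (simp add: mult_left_mono)
      qed
      ultimately show ?thesis
        using t False by (simp add: field_simps)
    qed
  qed
  have p_norm: "p z \<le> \<parallel>z\<parallel>" if "z \<in> \<C>" for z
    using p_le[OF that D(4)] that by simp
  have p_U: "p u \<le> 0" if "u \<in> U" for u
    using p_le[of u "(- 1) \<boxdot> u"] that D(3) by simp
  obtain r where r: "0 < r" "\<And>u. u \<in> U \<Longrightarrow> r \<le> \<parallel>x \<boxplus> (- 1) \<boxdot> u\<parallel>"
    using U(2) x unfolding closedin_norm_topology by blast
  have "r \<le> p x"
  proof (rule p_greatest)
    fix u assume "u \<in> U"
    then show "r \<le> \<parallel>x \<boxplus> u\<parallel>"
      using r(2)[of "(- 1) \<boxdot> u"] D(3) by simp
  qed
  then have px: "0 < p x"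
    using r(1) by simp
  note lower = sublinear_lower[OF \<open>sublinear p\<close> x(1)] lower_le[OF \<open>sublinear p\<close> x(1)]
    lower_minus[OF \<open>sublinear p\<close> x(1)]
  obtain q where q: "sublinear q" "\<forall>z\<in>\<C>. q z \<le> lower x p z"
    and minimal: "\<forall>r. sublinear r \<longrightarrow> (\<forall>x\<in>\<C>. r x \<le> q x) \<longrightarrow> (\<forall>x\<in>\<C>. r x = q x)"
    using exists_minimal_sublinear[OF lower(1)] by blast
  have add: "q (y \<boxplus> z) = q y + q z" if "y \<in> \<C>" "z \<in> \<C>" for y z
    using minimal_sublinear_additive[OF q(1) minimal that] .
  have q_le: "q z \<le> p z" if "z \<in> \<C>" for z
    using q(2) lower(2)[OF that] that by fastforce
  have minus: "q ((- 1) \<boxdot> z) = - q z" if "z \<in> \<C>" for z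
    using add[of z "(- 1) \<boxdot> z"] that sublinearD(3)[OF q(1)] by simp
  have real_scale: "q (complex_of_real t \<boxdot> z) = t * q z" if "z \<in> \<C>" for t z
  proof (cases "0 \<le> t")
    case True
    then show ?thesis
      using sublinearD(2)[OF q(1)] that by blast
  next
    case False
    have "q (complex_of_real (- t) \<boxdot> z) = - t * q z"
      using sublinearD(2)[OF q(1), of "- t" z] False that by simp
    then show ?thesis
      using minus[of "complex_of_real t \<boxdot> z"] that by simp
  qed
  have q_abs: "\<bar>q z\<bar> \<le> \<parallel>z\<parallel>" if "z \<in> \<C>" for z
    using q_le[OF that] p_norm[OF that] q_le[of "(- 1) \<boxdot> z"] p_norm[of "(- 1) \<boxdot> z"] minus[OF that] that
    by simp
  have q_U: "q u = 0" if "u \<in> U" for u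
    using q_le[of u] p_U[of u] q_le[of "(- 1) \<boxdot> u"] p_U[of "(- 1) \<boxdot> u"] minus[of u] that D(3) by simp
  have q_x: "q x \<noteq> 0"
    using bspec[OF q(2), of "(- 1) \<boxdot> x"] lower(3) minus[OF x(1)] px x(1) by simp
  define f where "f = (\<lambda>z\<in>\<C>. Complex (q z) (- q (\<i> \<boxdot> z)))"
  have complex_scale: "q (a \<boxdot> z) = Re a * q z + Im a * q (\<i> \<boxdot> z)" if "z \<in> \<C>" for a z
  proof -
    have "a = complex_of_real (Re a) + complex_of_real (Im a) * \<i>"
      by (simp add: complex_eq_iff)
    then have "a \<boxdot> z = complex_of_real (Re a) \<boxdot> z \<boxplus> complex_of_real (Im a) \<boxdot> (\<i> \<boxdot> z)"
      using that scale_add_left[OF that] by (metis scale_scale)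
    then show ?thesis
      using that by (simp add: add real_scale del: scale_scale)
  qed
  have "f \<in> vcarrier (dual_space V)"
    unfolding mem_dual_space linear_functional_iff
  proof (intro conjI ballI allI exI[of _ 2])
    show "f \<in> extensional \<C>"
      by (simp add: f_def)
    fix y z assume "y \<in> \<C>" "z \<in> \<C>"
    then show "f (y \<boxplus> z) = f y + f z"
      by (simp add: f_def add scale_add_right complex_eq_iff)
  next
    fix a z assume z: "z \<in> \<C>"
    have "q (\<i> \<boxdot> (a \<boxdot> z)) = Re a * q (\<i> \<boxdot> z) - Im a * q z"
      using complex_scale[OF z, of "\<i> * a"] z by simp
    then show "f (a \<boxdot> z) = a * f z"
      using z complex_scale[OF z, of a] by (simp add: f_def complex_eq_iff del: scale_scale)
  next
    fix z assume z: "z \<in> \<C>"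
    have "cmod (f z) \<le> \<bar>q z\<bar> + \<bar>q (\<i> \<boxdot> z)\<bar>"
      using cmod_le[of "f z"] z by (simp add: f_def)
    also have "\<dots> \<le> 2 * \<parallel>z\<parallel>"
      using q_abs[OF z] q_abs[of "\<i> \<boxdot> z"] z by (simp add: norm_scale)
    finally show "cmod (f z) \<le> 2 * \<parallel>z\<parallel>" .
  qed
  moreover have "f u = 0" if "u \<in> U" for u
    using that q_U D(3) by (simp add: f_def complex_eq_iff)
  moreover have "f x \<noteq> 0"
    using q_x x by (simp add: f_def complex_eq_iff)
  ultimately show thesis
    by (rule that)
qed

end

section \<open>Functionals that are continuous for a weak topology\<close>

text \<open>
  A basic neighbourhood of \<open>y\<close> restricts only finitely many functionals, so it contains every
  vector on which these functionals agree with \<open>y\<close>.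
\<close>

lemma weak_open_finite_functionals:
  assumes "openin (weak_topology Y X) W" "y \<in> W"
  obtains A where "finite A" "A \<subseteq> X"
    "\<And>z. \<lbrakk>z \<in> vcarrier Y; \<And>\<phi>. \<phi> \<in> A \<Longrightarrow> \<phi> z = \<phi> y\<rbrakk> \<Longrightarrow> z \<in> W"
proof -
  let ?S = "insert (vcarrier Y) {{y \<in> vcarrier Y. \<phi> y \<in> U} | \<phi> U. \<phi> \<in> X \<and> open U}"
  have "generate_topology_on ?S W"
    using assms(1) by (simp add: weak_topology_def openin_topology_generated_by_iff)
  then have "\<exists>A. finite A \<and> A \<subseteq> X \<and> (\<forall>z\<in>vcarrier Y. (\<forall>\<phi>\<in>A. \<phi> z = \<phi> y) \<longrightarrow> z \<in> W)"
    using assms(2)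
  proof induction
    case Empty
    then show ?case by simp
  next
    case (Int a b)
    then obtain A B where "finite A" "A \<subseteq> X" "\<forall>z\<in>vcarrier Y. (\<forall>\<phi>\<in>A. \<phi> z = \<phi> y) \<longrightarrow> z \<in> a"
      "finite B" "B \<subseteq> X" "\<forall>z\<in>vcarrier Y. (\<forall>\<phi>\<in>B. \<phi> z = \<phi> y) \<longrightarrow> z \<in> b"
      by auto
    then show ?case
      by (intro exI[of _ "A \<union> B"]) auto
  next
    case (UN K)
    then obtain k where "k \<in> K" "y \<in> k"
      by auto
    then show ?case
      using UN.IH[OF \<open>k \<in> K\<close> \<open>y \<in> k\<close>] by blast
  next
    case (Basis s)
    then consider "s = vcarrier Y" | \<phi> U where "\<phi> \<in> X" "s = {y \<in> vcarrier Y. \<phi> y \<in> U}"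
      by auto
    then show ?case
    proof cases
      case 1
      then show ?thesis
        by (intro exI[of _ "{}"]) simp
    next
      case 2
      then show ?thesis
        using Basis(2) by (intro exI[of _ "{\<phi>}"]) simp
    qed
  qed
  then obtain A where "finite A" "A \<subseteq> X" "\<forall>z\<in>vcarrier Y. (\<forall>\<phi>\<in>A. \<phi> z = \<phi> y) \<longrightarrow> z \<in> W"
    by blast
  then show thesis
    by (intro that[of A]) auto
qed

text \<open>
  By induction on \<open>A\<close>: subtracting from \<open>\<psi>\<close> a suitable multiple of \<open>\<phi>\<close> gives a functional that
  vanishes where the functionals of \<open>A - {\<phi>}\<close> do.
\<close>

lemma (in complex_normed_space) functional_in_subspace_if_vanishes_on_kernels:
  assumes X: "vsubspace (dual_space V) X"
    and "finite A" "A \<subseteq> X" "\<psi> \<in> vcarrier (dual_space V)"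
    and "\<And>y. \<lbrakk>y \<in> \<C>; \<And>\<phi>. \<phi> \<in> A \<Longrightarrow> \<phi> y = 0\<rbrakk> \<Longrightarrow> \<psi> y = 0"
  shows "\<psi> \<in> X"
  using assms(2-)
proof (induction A arbitrary: \<psi> rule: finite_induct)
  interpret D: complex_normed_space "dual_space V"
    by (rule dual_space_complex_normed_space) unfold_locales
  case empty
  have "\<psi> = vscale (dual_space V) 0 \<psi>"
    using empty dual_spaceD(1)[of \<psi> V] by (auto simp: extensional_def fun_eq_iff)
  then have "\<psi> = D.zero"
    using empty D.scale_zero_left by metis
  then show ?case
    using D.vsubspaceD(4)[OF X] by simp
next
  interpret D: complex_normed_space "dual_space V"
    by (rule dual_space_complex_normed_space) unfold_locales
  case (insert \<phi> A)
  note XD = D.vsubspaceD[OF X]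
  have \<phi>: "\<phi> \<in> X" "\<phi> \<in> vcarrier (dual_space V)"
    using insert.prems XD(1) by auto
  show ?case
  proof (cases "\<exists>y\<in>\<C>. (\<forall>\<theta>\<in>A. \<theta> y = 0) \<and> \<phi> y \<noteq> 0")
    case False
    then show ?thesis
      using insert.prems by (intro insert.IH) auto
  next
    case True
    then obtain y where y: "y \<in> \<C>" "\<And>\<theta>. \<theta> \<in> A \<Longrightarrow> \<theta> y = 0" "\<phi> y \<noteq> 0"
      by blast
    \<comment> \<open>Every \<open>z\<close> in the common kernel of \<open>A\<close> differs from a multiple of \<open>y\<close> by a vector
      that \<open>\<phi>\<close> kills too, hence \<open>\<psi>\<close> is a multiple of \<open>\<phi>\<close> on this kernel.\<close>
    define c where "c = \<psi> y / \<phi> y"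
    let ?\<psi> = "vadd (dual_space V) \<psi> (vscale (dual_space V) (- c) \<phi>)"
    have "?\<psi> \<in> X"
    proof (rule insert.IH)
      show "?\<psi> \<in> vcarrier (dual_space V)"
        using insert.prems \<phi> by (intro D.add_closed D.scale_closed)
      fix z assume z: "z \<in> \<C>" "\<And>\<theta>. \<theta> \<in> A \<Longrightarrow> \<theta> z = 0"
      let ?w = "z \<boxplus> (- (\<phi> z / \<phi> y)) \<boxdot> y"
      have w: "\<theta> ?w = \<theta> z - \<phi> z / \<phi> y * \<theta> y" if "\<theta> \<in> vcarrier (dual_space V)" for \<theta>
        using z y that by (simp add: dual_spaceD(2,3))
      have "\<psi> ?w = 0"
      proof (rule insert.prems)
        fix \<theta> assume \<theta>: "\<theta> \<in> insert \<phi> A"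
        then have "\<theta> \<in> vcarrier (dual_space V)"
          using insert.prems(1) XD(1) by blast
        then show "\<theta> ?w = 0"
          using w[of \<theta>] z(1) z(2)[of \<theta>] y(1,3) y(2)[of \<theta>] \<theta> by auto
      qed (use z y in simp)
      then show "?\<psi> z = 0"
        using w[OF insert.prems(2)] z(1) by (simp add: c_def)
    qed (use insert.prems in auto)
    then have "vadd (dual_space V) ?\<psi> (vscale (dual_space V) c \<phi>) \<in> X"
      using XD(2,3) \<phi> by blast
    moreover have "vadd (dual_space V) ?\<psi> (vscale (dual_space V) c \<phi>) = \<psi>"
      using dual_spaceD(1)[OF insert.prems(2)] by (auto simp: extensional_def fun_eq_iff)
    ultimately show ?thesis
      by simp
  qed
qed

section \<open>Matrices as a normed space\<close>

notation Matrix.vec_index (infixl "$v" 100)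

lemma cvec_space_complex_normed_space: "complex_normed_space (cvec_space n)"
proof
  let ?V = "cvec_space n"
  have sel: "vcarrier ?V = carrier_vec n" "vadd ?V = (+)" "vscale ?V = (\<cdot>\<^sub>v)"
    "vnorm ?V v = L2_set (\<lambda>i. cmod (v $v i)) {..<dim_vec v}" for v
    by (simp_all add: cvec_space_def)
  fix x y z :: "complex Matrix.vec" and a b
  assume x: "x \<in> vcarrier ?V"
  show "vscale ?V a x \<in> vcarrier ?V" "vscale ?V a (vscale ?V b x) = vscale ?V (a * b) x"
    "vscale ?V 1 x = x" "vscale ?V (a + b) x = vadd ?V (vscale ?V a x) (vscale ?V b x)"
    using x by (auto simp: sel distrib_right)
  show "vnorm ?V (vscale ?V a x) = cmod a * vnorm ?V x"
    using x by (simp add: sel L2_set_right_distrib norm_mult cong: L2_set_cong_simp)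
  show "vscale ?V 0 x = x" if "vnorm ?V x = 0"
    using x that by (intro eq_vecI) (auto simp: sel L2_set_eq_0_iff)
  assume y: "y \<in> vcarrier ?V"
  show "vadd ?V x y \<in> vcarrier ?V" "vadd ?V x y = vadd ?V y x"
    "vscale ?V a (vadd ?V x y) = vadd ?V (vscale ?V a x) (vscale ?V a y)"
    using x y by (auto simp: sel distrib_left)
  have "vnorm ?V (vadd ?V x y) = L2_set (\<lambda>i. cmod (x $v i + y $v i)) {..<n}"
    using x y by (simp add: sel cong: L2_set_cong_simp)
  also have "\<dots> \<le> L2_set (\<lambda>i. cmod (x $v i) + cmod (y $v i)) {..<n}"
    by (intro L2_set_mono norm_triangle_ineq) auto
  also have "\<dots> \<le> vnorm ?V x + vnorm ?V y"
    using x y by (simp add: sel L2_set_triangle_ineq)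
  finally show "vnorm ?V (vadd ?V x y) \<le> vnorm ?V x + vnorm ?V y" .
  assume z: "z \<in> vcarrier ?V"
  show "vadd ?V (vadd ?V x y) z = vadd ?V x (vadd ?V y z)"
    using x y z by (auto simp: sel)
next
  show "\<exists>z\<in>vcarrier (cvec_space n). \<forall>x\<in>vcarrier (cvec_space n). vscale (cvec_space n) 0 x = z"
    by (intro bexI[of _ "0\<^sub>v n"]) (auto simp: cvec_space_def)
qed

abbreviation vec_norm :: "complex Matrix.vec \<Rightarrow> real" where
  "vec_norm v \<equiv> L2_set (\<lambda>i. cmod (v $v i)) {..<dim_vec v}"

lemma mat_norm_eq_opnorm:
  "A \<in> carrier_mat n n \<Longrightarrow> mat_norm A = opnorm (cvec_space n) (cvec_space n) ((*\<^sub>v) A)"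
  by (auto simp: mat_norm_def)

lemma vec_norm_mult_mat_vec_le:
  assumes A: "A \<in> carrier_mat n n" and u: "u \<in> carrier_vec n"
  shows "vec_norm (A *\<^sub>v u) \<le> (\<Sum>i<n. \<Sum>k<n. cmod (A $$ (i, k))) * vec_norm u"
proof -
  have entry: "cmod ((A *\<^sub>v u) $v i) \<le> (\<Sum>k<n. cmod (A $$ (i, k))) * vec_norm u" if "i < n" for i
  proof -
    have "(A *\<^sub>v u) $v i = (\<Sum>k<n. A $$ (i, k) * u $v k)"
      using A u that by (simp add: scalar_prod_def lessThan_atLeast0)
    also have "cmod \<dots> \<le> (\<Sum>k<n. cmod (A $$ (i, k)) * cmod (u $v k))"
      by (rule order_trans[OF norm_sum]) (simp add: norm_mult)
    also have "\<dots> \<le> (\<Sum>k<n. cmod (A $$ (i, k)) * vec_norm u)"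
      using u by (intro sum_mono mult_left_mono member_le_L2_set) auto
    finally show ?thesis
      by (simp add: sum_distrib_right)
  qed
  have "vec_norm (A *\<^sub>v u) \<le> (\<Sum>i<n. cmod ((A *\<^sub>v u) $v i))"
    using A by (simp add: L2_set_le_sum del: index_mult_mat_vec)
  also have "\<dots> \<le> (\<Sum>i<n. (\<Sum>k<n. cmod (A $$ (i, k))) * vec_norm u)"
    using entry by (intro sum_mono) auto
  finally show ?thesis
    by (simp add: sum_distrib_right)
qed

lemma mult_mat_vec_bounded:
  assumes A: "A \<in> carrier_mat n n"
  shows "bounded_linear_map (cvec_space n) (cvec_space n) ((*\<^sub>v) A)"
proof (rule bounded_linear_mapI)
  show "linear_map (cvec_space n) (cvec_space n) ((*\<^sub>v) A)"
    using A by (auto simp: linear_map_def cvec_space_def mult_add_distrib_mat_vec mult_mat_vec)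
  show "vnorm (cvec_space n) (A *\<^sub>v u) \<le>
      (\<Sum>i<n. \<Sum>k<n. cmod (A $$ (i, k))) * vnorm (cvec_space n) u"
    if "u \<in> vcarrier (cvec_space n)" for u
    using vec_norm_mult_mat_vec_le[OF A, of u] that by (simp add: cvec_space_def)
qed

lemma mat_norm_bound:
  assumes "A \<in> carrier_mat n n" "u \<in> carrier_vec n"
  shows "vec_norm (A *\<^sub>v u) \<le> mat_norm A * vec_norm u"
  using opnorm_bound[OF cvec_space_complex_normed_space cvec_space_complex_normed_space
      mult_mat_vec_bounded[OF assms(1)], of u] assms
  by (simp add: mat_norm_eq_opnorm) (simp add: cvec_space_def)

lemma mat_norm_le:
  assumes "A \<in> carrier_mat n n"
    and "\<And>u. \<lbrakk>u \<in> carrier_vec n; vec_norm u \<le> 1\<rbrakk> \<Longrightarrow> vec_norm (A *\<^sub>v u) \<le> C"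
  shows "mat_norm A \<le> C"
  unfolding mat_norm_eq_opnorm[OF assms(1)]
  by (rule opnorm_le[OF cvec_space_complex_normed_space]) (use assms(2) in \<open>simp add: cvec_space_def\<close>)

lemma mat_norm_le_sum_entries:
  assumes A: "A \<in> carrier_mat n n"
  shows "mat_norm A \<le> (\<Sum>i<n. \<Sum>k<n. cmod (A $$ (i, k)))"
proof (rule mat_norm_le[OF A])
  fix u :: "complex Matrix.vec" assume u: "u \<in> carrier_vec n" "vec_norm u \<le> 1"
  have "(\<Sum>i<n. \<Sum>k<n. cmod (A $$ (i, k))) * vec_norm u \<le> (\<Sum>i<n. \<Sum>k<n. cmod (A $$ (i, k)))"
    using u(2) by (intro mult_left_le sum_nonneg) auto
  then show "vec_norm (A *\<^sub>v u) \<le> (\<Sum>i<n. \<Sum>k<n. cmod (A $$ (i, k)))"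
    using vec_norm_mult_mat_vec_le[OF A u(1)] by linarith
qed

lemma mat_norm_nonneg: "A \<in> carrier_mat n n \<Longrightarrow> 0 \<le> mat_norm A"
  using opnorm_nonneg[OF cvec_space_complex_normed_space cvec_space_complex_normed_space
      mult_mat_vec_bounded] by (simp add: mat_norm_eq_opnorm)

lemma entry_le_mat_norm:
  assumes A: "A \<in> carrier_mat n n" and ij: "i < n" "j < n"
  shows "cmod (A $$ (i, j)) \<le> mat_norm A"
proof -
  have "A $$ (i, j) = (A *\<^sub>v unit_vec n j) $v i"
    using A ij by simp
  also have "cmod \<dots> \<le> vec_norm (A *\<^sub>v unit_vec n j)"
    using A ij by (intro member_le_L2_set) auto
  also have "\<dots> \<le> mat_norm A * vec_norm (unit_vec n j)"
    by (rule mat_norm_bound[OF A]) simp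
  also have "vec_norm (unit_vec n j :: complex Matrix.vec) = 1"
  proof -
    have "(\<Sum>i<n. (cmod (unit_vec n j $v i))\<^sup>2) = (\<Sum>i<n. if i = j then 1 else 0)"
      using ij by (intro sum.cong) auto
    then show ?thesis
      using ij by (simp add: L2_set_def)
  qed
  finally show ?thesis by simp
qed

lemma mat_norm_add_le:
  assumes A: "A \<in> carrier_mat n n" and B: "B \<in> carrier_mat n n"
  shows "mat_norm (A + B) \<le> mat_norm A + mat_norm B"
proof (rule mat_norm_le)
  show "A + B \<in> carrier_mat n n"
    using A B by simp
  fix u :: "complex Matrix.vec" assume u: "u \<in> carrier_vec n" "vec_norm u \<le> 1"
  interpret complex_normed_space "cvec_space n"
    by (rule cvec_space_complex_normed_space)
  have "vec_norm ((A + B) *\<^sub>v u) \<le> vec_norm (A *\<^sub>v u) + vec_norm (B *\<^sub>v u)"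
    using norm_triangle[of "A *\<^sub>v u" "B *\<^sub>v u"] A B u
    by (simp add: cvec_space_def add_mult_distrib_mat_vec[OF A B u(1)])
  also have "\<dots> \<le> mat_norm A * vec_norm u + mat_norm B * vec_norm u"
    by (intro add_mono mat_norm_bound[OF A u(1)] mat_norm_bound[OF B u(1)])
  also have "\<dots> \<le> mat_norm A + mat_norm B"
    using u(2) mat_norm_nonneg[OF A] mat_norm_nonneg[OF B] by (intro add_mono mult_left_le) auto
  finally show "vec_norm ((A + B) *\<^sub>v u) \<le> mat_norm A + mat_norm B" .
qed

lemma mat_norm_smult_le:
  assumes A: "A \<in> carrier_mat n n"
  shows "mat_norm (a \<cdot>\<^sub>m A) \<le> cmod a * mat_norm A"
proof (rule mat_norm_le)
  show "a \<cdot>\<^sub>m A \<in> carrier_mat n n"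
    using A by simp
  fix u :: "complex Matrix.vec" assume u: "u \<in> carrier_vec n" "vec_norm u \<le> 1"
  interpret complex_normed_space "cvec_space n"
    by (rule cvec_space_complex_normed_space)
  have "(a \<cdot>\<^sub>m A) *\<^sub>v u = a \<cdot>\<^sub>v (A *\<^sub>v u)"
    using A u by (intro eq_vecI) auto
  then have "vec_norm ((a \<cdot>\<^sub>m A) *\<^sub>v u) = cmod a * vec_norm (A *\<^sub>v u)"
    using norm_scale[of "A *\<^sub>v u" a] A u by (simp add: cvec_space_def)
  also have "\<dots> \<le> cmod a * (mat_norm A * vec_norm u)"
    by (intro mult_left_mono mat_norm_bound[OF A u(1)]) simp
  also have "\<dots> \<le> cmod a * mat_norm A"
    using u(2) mat_norm_nonneg[OF A] by (intro mult_left_mono mult_left_le) auto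
  finally show "vec_norm ((a \<cdot>\<^sub>m A) *\<^sub>v u) \<le> cmod a * mat_norm A" .
qed

lemma mat_norm_smult:
  assumes A: "A \<in> carrier_mat n n"
  shows "mat_norm (a \<cdot>\<^sub>m A) = cmod a * mat_norm A"
proof (cases "a = 0")
  case True
  then show ?thesis
    using mat_norm_smult_le[OF A, of 0] mat_norm_nonneg[of "0 \<cdot>\<^sub>m A" n] A by simp
next
  case False
  have "A = (1 / a) \<cdot>\<^sub>m (a \<cdot>\<^sub>m A)"
    using False by (intro eq_matI) auto
  then have "mat_norm A \<le> cmod (1 / a) * mat_norm (a \<cdot>\<^sub>m A)"
    using mat_norm_smult_le[of "a \<cdot>\<^sub>m A" n "1 / a"] A by simp
  then show ?thesis
    using mat_norm_smult_le[OF A, of a] False by (simp add: norm_divide field_simps)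
qed

lemma mat_norm_eq_0:
  assumes A: "A \<in> carrier_mat n n" and "mat_norm A = 0"
  shows "A = 0\<^sub>m n n"
  using entry_le_mat_norm[OF A] assms by (intro eq_matI) auto

lemma mat_space_sel [simp]:
  "vcarrier (mat_space n) = carrier_mat n n" "vadd (mat_space n) = (+)"
  "vscale (mat_space n) = (\<cdot>\<^sub>m)" "vnorm (mat_space n) = mat_norm"
  by (simp_all add: mat_space_def)

lemma mat_space_complex_normed_space: "complex_normed_space (mat_space n)"
proof
  fix A assume "A \<in> vcarrier (mat_space n)" "vnorm (mat_space n) A = 0"
  then show "vscale (mat_space n) 0 A = A"
    using mat_norm_eq_0[of A n] by auto
next
  show "\<exists>z\<in>vcarrier (mat_space n). \<forall>x\<in>vcarrier (mat_space n). vscale (mat_space n) 0 x = z"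
    by (intro bexI[of _ "0\<^sub>m n n"]) auto
qed (auto simp: mat_norm_add_le mat_norm_smult add_smult_distrib_left_mat add_smult_distrib_right_mat
  intro: comm_add_mat)

subsection \<open>Linear functionals on matrices\<close>

abbreviation matrix_unit :: "nat \<Rightarrow> nat \<times> nat \<Rightarrow> complex mat" where
  "matrix_unit n p \<equiv> mat n n (\<lambda>q. if q = p then 1 else 0)"

lemma mat_functional_expansion:
  assumes lin: "linear_map (mat_space n) complex_field_space \<eta>" and A: "A \<in> carrier_mat n n"
  shows "\<eta> A = (\<Sum>p\<in>{..<n} \<times> {..<n}. A $$ p * \<eta> (matrix_unit n p))"
proof -
  have add: "\<eta> (B + C) = \<eta> B + \<eta> C" if "B \<in> carrier_mat n n" "C \<in> carrier_mat n n" for B C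
    using lin that by (auto simp: linear_functional_iff)
  have scale: "\<eta> (a \<cdot>\<^sub>m B) = a * \<eta> B" if "B \<in> carrier_mat n n" for B a
    using lin that by (auto simp: linear_functional_iff)
  have partial: "\<eta> (mat n n (\<lambda>q. if q \<in> S then A $$ q else 0)) = (\<Sum>p\<in>S. A $$ p * \<eta> (matrix_unit n p))"
    if "finite S" for S
    using that
  proof induction
    case empty
    have "mat n n (\<lambda>q. 0) = 0 \<cdot>\<^sub>m A"
      using A by (intro eq_matI) auto
    then show ?case
      using scale[OF A, of 0] by simp
  next
    case (insert p S)
    have "mat n n (\<lambda>q. if q \<in> insert p S then A $$ q else 0) =
        A $$ p \<cdot>\<^sub>m matrix_unit n p + mat n n (\<lambda>q. if q \<in> S then A $$ q else 0)"
      using insert.hyps by (intro eq_matI) auto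
    then show ?case
      using insert by (simp add: add scale)
  qed
  have full: "mat n n (\<lambda>q. if q \<in> {..<n} \<times> {..<n} then A $$ q else 0) = A"
    using A by (intro eq_matI) auto
  show ?thesis
    using partial[of "{..<n} \<times> {..<n}"] unfolding full by blast
qed

text \<open>On \<open>M\<^sub>n\<close> boundedness is automatic, because a linear functional is a combination of the
  matrix entries.\<close>

lemma mat_functional_in_dual:
  assumes "\<eta> \<in> extensional (carrier_mat n n)" "linear_map (mat_space n) complex_field_space \<eta>"
  shows "\<eta> \<in> vcarrier (dual_space (mat_space n))"
proof -
  let ?I = "{..<n} \<times> {..<n}"
  have "cmod (\<eta> A) \<le> (\<Sum>p\<in>?I. cmod (\<eta> (matrix_unit n p))) * mat_norm A"
    if A: "A \<in> carrier_mat n n" for A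
  proof -
    have "cmod (\<eta> A) \<le> (\<Sum>p\<in>?I. cmod (A $$ p) * cmod (\<eta> (matrix_unit n p)))"
      unfolding mat_functional_expansion[OF assms(2) A]
      by (rule order_trans[OF norm_sum]) (simp add: norm_mult)
    also have "\<dots> \<le> (\<Sum>p\<in>?I. mat_norm A * cmod (\<eta> (matrix_unit n p)))"
      using entry_le_mat_norm[OF A] by (intro sum_mono mult_right_mono) auto
    finally show ?thesis
      by (simp add: sum_distrib_left mult.commute)
  qed
  then show ?thesis
    using assms by (auto simp: mem_dual_space)
qed

definition entry_functional :: "nat \<Rightarrow> nat \<times> nat \<Rightarrow> complex mat \<Rightarrow> complex" where
  "entry_functional n p = (\<lambda>A\<in>carrier_mat n n. A $$ p)"

lemma entry_functional_in_dual:
  assumes "p \<in> {..<n} \<times> {..<n}"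
  shows "entry_functional n p \<in> vcarrier (dual_space (mat_space n))"
  by (rule mat_functional_in_dual) (use assms in \<open>auto simp: entry_functional_def linear_functional_iff\<close>)

definition vector_functional ::
  "nat \<Rightarrow> complex Matrix.vec \<Rightarrow> complex Matrix.vec \<Rightarrow> complex mat \<Rightarrow> complex" where
  "vector_functional n u v = (\<lambda>A\<in>carrier_mat n n. \<Sum>i<n. cnj (v $v i) * (A *\<^sub>v u) $v i)"

lemma vector_functional_in_dual:
  assumes u: "u \<in> carrier_vec n"
  shows "vector_functional n u v \<in> vcarrier (dual_space (mat_space n))"
proof (rule mat_functional_in_dual)
  have add: "((A + B) *\<^sub>v u) $v i = (A *\<^sub>v u) $v i + (B *\<^sub>v u) $v i"
    if "A \<in> carrier_mat n n" "B \<in> carrier_mat n n" "i < n" for A B i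
    using that by (simp add: add_mult_distrib_mat_vec[OF that(1,2) u] del: index_mult_mat_vec)
  have scale: "((a \<cdot>\<^sub>m A) *\<^sub>v u) $v i = a * (A *\<^sub>v u) $v i"
    if "A \<in> carrier_mat n n" "i < n" for A a i
    using that u by simp
  show "linear_map (mat_space n) complex_field_space (vector_functional n u v)"
    unfolding linear_functional_iff mat_space_sel
  proof (intro conjI ballI allI)
    fix A B :: "complex mat" assume "A \<in> carrier_mat n n" "B \<in> carrier_mat n n"
    then show "vector_functional n u v (A + B) = vector_functional n u v A + vector_functional n u v B"
      unfolding vector_functional_def sum.distrib[symmetric]
      by (simp add: add distrib_left sum.distrib del: index_mult_mat_vec)
  next
    fix a and A :: "complex mat" assume "A \<in> carrier_mat n n"
    then show "vector_functional n u v (a \<cdot>\<^sub>m A) = a * vector_functional n u v A"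
      by (simp add: vector_functional_def scale sum_distrib_left mult.left_commute
          del: index_mult_mat_vec)
  qed
qed (simp add: vector_functional_def)

lemma vector_functional_le:
  assumes A: "A \<in> carrier_mat n n" and u: "u \<in> carrier_vec n" "vec_norm u \<le> 1"
    and v: "v \<in> carrier_vec n" "vec_norm v \<le> 1"
  shows "cmod (vector_functional n u v A) \<le> mat_norm A"
proof -
  have "cmod (vector_functional n u v A) \<le> (\<Sum>i<n. \<bar>cmod (v $v i)\<bar> * \<bar>cmod ((A *\<^sub>v u) $v i)\<bar>)"
    using A by (simp add: vector_functional_def del: index_mult_mat_vec)
      (rule order_trans[OF norm_sum], simp add: norm_mult del: index_mult_mat_vec)
  also have "\<dots> \<le> vec_norm v * vec_norm (A *\<^sub>v u)"
    using L2_set_mult_ineq[of "\<lambda>i. cmod (v $v i)" "\<lambda>i. cmod ((A *\<^sub>v u) $v i)" "{..<n}"] A v by simp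
  also have "\<dots> \<le> 1 * (mat_norm A * 1)"
    using mat_norm_bound[OF A u(1)] u(2) v(2) mat_norm_nonneg[OF A]
    by (intro mult_mono order_trans[OF mat_norm_bound[OF A u(1)]] mult_left_mono) auto
  finally show ?thesis by simp
qed

text \<open>The vector functionals are norming; at \<open>u\<close> the bound is attained for \<open>v = A u / \<parallel>A u\<parallel>\<close>.\<close>

lemma mat_norm_le_if_vector_functional_le:
  assumes A: "A \<in> carrier_mat n n" and "0 \<le> C"
    and le: "\<And>u v. \<lbrakk>u \<in> carrier_vec n; vec_norm u \<le> 1; v \<in> carrier_vec n; vec_norm v \<le> 1\<rbrakk> \<Longrightarrow>
      cmod (vector_functional n u v A) \<le> C"
  shows "mat_norm A \<le> C"
proof (rule mat_norm_le[OF A])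
  fix u :: "complex Matrix.vec" assume u: "u \<in> carrier_vec n" "vec_norm u \<le> 1"
  define w where "w = A *\<^sub>v u"
  have w: "w \<in> carrier_vec n"
    using mult_mat_vec_carrier[OF A u(1)] by (simp add: w_def)
  define r where "r = vec_norm w"
  show "vec_norm (A *\<^sub>v u) \<le> C"
  proof (cases "r = 0")
    case True
    then show ?thesis
      using \<open>0 \<le> C\<close> by (simp add: r_def w_def)
  next
    case False
    then have "0 < r"
      using L2_set_nonneg[of "\<lambda>i. cmod (w $v i)" "{..<dim_vec w}"] by (simp add: r_def less_le)
    interpret complex_normed_space "cvec_space n"
      by (rule cvec_space_complex_normed_space)
    let ?v = "complex_of_real (1 / r) \<cdot>\<^sub>v w"
    have "vec_norm ?v = cmod (complex_of_real (1 / r)) * vec_norm w"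
      using norm_scale[of w "complex_of_real (1 / r)"] w by (simp add: cvec_space_def)
    also have "\<dots> = cmod (complex_of_real (1 / r)) * r"
      by (simp add: r_def)
    finally have "vec_norm ?v = 1"
      using \<open>0 < r\<close> by (simp add: norm_divide)
    then have "cmod (vector_functional n u ?v A) \<le> C"
      using u w by (intro le) auto
    moreover have "vector_functional n u ?v A = complex_of_real r"
    proof -
      have "vector_functional n u ?v A = (\<Sum>i<n. complex_of_real (1 / r) * (cnj (w $v i) * w $v i))"
        using A w by (simp add: vector_functional_def mult.assoc flip: w_def)
      also have "\<dots> = complex_of_real (1 / r * (\<Sum>i<n. (cmod (w $v i))\<^sup>2))"
        unfolding of_real_mult of_real_sum sum_distrib_left
        by (intro sum.cong refl) (metis complex_norm_square mult.commute)
      also have "(\<Sum>i<n. (cmod (w $v i))\<^sup>2) = r\<^sup>2"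
        using w by (simp add: r_def L2_set_def sum_nonneg)
      finally show ?thesis
        using \<open>0 < r\<close> by (simp add: power2_eq_square)
    qed
    ultimately show ?thesis
      using \<open>0 < r\<close> by (simp add: r_def w_def)
  qed
qed

section \<open>The operator ball\<close>

lemma scaleC_zero_left [simp]: "0 *\<^sub>C (x :: 'a::complex_hilbert) = 0"
  using scaleR_scaleC[of 0 x] by simp

lemma scaleC_zero_right [simp]: "a *\<^sub>C (0 :: 'a::complex_hilbert) = 0"
  using scaleC_scaleC[of a 0 "0 :: 'a"] by simp

lemma scaleC_sum_right: "a *\<^sub>C (\<Sum>i\<in>I. f i :: 'a::complex_hilbert) = (\<Sum>i\<in>I. a *\<^sub>C f i)"
  by (induction I rule: infinite_finite_induct) (simp_all add: scaleC_add_right)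

lemma norm_scaleC: "norm (a *\<^sub>C (x :: 'a::complex_hilbert)) = cmod a * norm x"
proof -
  have "complex_of_real ((norm (a *\<^sub>C x))\<^sup>2) = a * cinner (a *\<^sub>C x) x"
    by (metis cinner_self cinner_scaleC_right)
  also have "cinner (a *\<^sub>C x) x = cnj (a * cinner x x)"
    by (metis cinner_commute cinner_scaleC_right)
  also have "a * \<dots> = complex_of_real ((cmod a * norm x)\<^sup>2)"
    unfolding cinner_self by (simp add: power_mult_distrib mult.assoc flip: complex_norm_square)
  finally have "(norm (a *\<^sub>C x))\<^sup>2 = (cmod a * norm x)\<^sup>2"
    using of_real_eq_iff by blast
  then show ?thesis
    by (simp add: power2_eq_iff_nonneg)
qed

lemma hilbert_power_sel [simp]:
  "vcarrier (hilbert_power n) = extensional {..<n}"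
  "vadd (hilbert_power n) v w = (\<lambda>i\<in>{..<n}. v i + w i)"
  "vscale (hilbert_power n) a v = (\<lambda>i\<in>{..<n}. a *\<^sub>C v i)"
  "vnorm (hilbert_power n) v = L2_set (\<lambda>i. norm (v i)) {..<n}"
  by (simp_all add: hilbert_power_def)

lemma hilbert_power_complex_normed_space:
  "complex_normed_space (hilbert_power n :: (nat \<Rightarrow> 'a::complex_hilbert) cnspace)"
proof
  let ?V = "hilbert_power n :: (nat \<Rightarrow> 'a) cnspace"
  fix x y z :: "nat \<Rightarrow> 'a" and a b
  assume x: "x \<in> vcarrier ?V"
  then have ext: "x i = undefined" if "\<not> i < n" for i
    using that by (simp add: extensional_def)
  show "vscale ?V a x \<in> vcarrier ?V" "vscale ?V a (vscale ?V b x) = vscale ?V (a * b) x"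
    "vscale ?V (a + b) x = vadd ?V (vscale ?V a x) (vscale ?V b x)"
    by (auto simp: fun_eq_iff scaleC_scaleC scaleC_add_left)
  show "vscale ?V 1 x = x"
    using ext by (auto simp: fun_eq_iff scaleC_one)
  show "vnorm ?V (vscale ?V a x) = cmod a * vnorm ?V x"
    by (simp add: L2_set_right_distrib norm_scaleC cong: L2_set_cong_simp)
  show "vscale ?V 0 x = x" if "vnorm ?V x = 0"
    using that ext by (auto simp: L2_set_eq_0_iff fun_eq_iff)
  assume y: "y \<in> vcarrier ?V"
  show "vadd ?V x y \<in> vcarrier ?V" "vadd ?V x y = vadd ?V y x"
    "vscale ?V a (vadd ?V x y) = vadd ?V (vscale ?V a x) (vscale ?V a y)"
    by (auto simp: fun_eq_iff scaleC_add_right)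
  have "vnorm ?V (vadd ?V x y) \<le> L2_set (\<lambda>i. norm (x i) + norm (y i)) {..<n}"
    by (simp, intro L2_set_mono) (auto intro: norm_triangle_ineq)
  also have "\<dots> \<le> vnorm ?V x + vnorm ?V y"
    by (simp add: L2_set_triangle_ineq)
  finally show "vnorm ?V (vadd ?V x y) \<le> vnorm ?V x + vnorm ?V y" .
  show "vadd ?V (vadd ?V x y) z = vadd ?V x (vadd ?V y z)"
    by (auto simp: fun_eq_iff)
next
  show "\<exists>z\<in>vcarrier (hilbert_power n :: (nat \<Rightarrow> 'a) cnspace).
      \<forall>x\<in>vcarrier (hilbert_power n). vscale (hilbert_power n) 0 x = z"
    by (intro bexI[of _ "\<lambda>i\<in>{..<n}. 0"]) auto
qed

lemma pencil_bounded:
  fixes Q :: "'d::finite \<Rightarrow> 'r::complex_hilbert \<Rightarrow> 's::complex_hilbert"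
  assumes Q: "\<forall>j. bounded_clinear (Q j)"
  shows "bounded_linear_map (hilbert_power n) (hilbert_power n) (pencil n Q X)"
proof (rule bounded_linear_mapI)
  have bl: "bounded_linear (Q j)" and sc: "Q j (a *\<^sub>C x) = a *\<^sub>C Q j x" for j a x
    using Q by (auto simp: bounded_clinear_def)
  have add: "Q j (x + y) = Q j x + Q j y" for j x y
    using bl by (simp add: linear_simps)
  show "linear_map (hilbert_power n) (hilbert_power n) (pencil n Q X)"
    unfolding linear_map_def
  proof (intro conjI ballI allI)
    show "pencil n Q X \<in> vcarrier (hilbert_power n) \<rightarrow> vcarrier (hilbert_power n)"
      by (simp add: pencil_def)
    fix v w :: "nat \<Rightarrow> 'r"
    show "pencil n Q X (vadd (hilbert_power n) v w) =
        vadd (hilbert_power n) (pencil n Q X v) (pencil n Q X w)"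
      by (auto simp: fun_eq_iff pencil_def add scaleC_add_right sum.distrib)
  next
    fix a and v :: "nat \<Rightarrow> 'r"
    show "pencil n Q X (vscale (hilbert_power n) a v) = vscale (hilbert_power n) a (pencil n Q X v)"
      by (auto simp: fun_eq_iff pencil_def sc scaleC_sum_right scaleC_scaleC mult.commute)
  qed
  fix v :: "nat \<Rightarrow> 'r"
  let ?N = "L2_set (\<lambda>i. norm (v i)) {..<n}"
  have entry: "norm (pencil n Q X v i) \<le> (\<Sum>j\<in>UNIV. \<Sum>k<n. cmod (X j $$ (i, k)) * onorm (Q j)) * ?N"
    if "i < n" for i
  proof -
    have summand: "norm ((X j $$ (i, k)) *\<^sub>C Q j (v k)) \<le> cmod (X j $$ (i, k)) * onorm (Q j) * ?N"
      if "k < n" for j k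
    proof -
      have "norm (Q j (v k)) \<le> onorm (Q j) * norm (v k)"
        by (rule onorm[OF bl])
      also have "\<dots> \<le> onorm (Q j) * ?N"
        using that by (intro mult_left_mono member_le_L2_set onorm_pos_le[OF bl]) auto
      finally show ?thesis
        by (simp add: norm_scaleC mult.assoc mult_left_mono)
    qed
    have "norm (pencil n Q X v i) \<le> (\<Sum>j\<in>UNIV. \<Sum>k<n. norm ((X j $$ (i, k)) *\<^sub>C Q j (v k)))"
      using that by (simp add: pencil_def) (intro order_trans[OF norm_sum] sum_mono norm_sum)
    also have "\<dots> \<le> (\<Sum>j\<in>UNIV. \<Sum>k<n. cmod (X j $$ (i, k)) * onorm (Q j) * ?N)"
      using summand by (intro sum_mono) auto
    finally show ?thesis
      by (simp add: sum_distrib_right)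
  qed
  have "vnorm (hilbert_power n) (pencil n Q X v) \<le> (\<Sum>i<n. norm (pencil n Q X v i))"
    by (simp add: L2_set_le_sum)
  also have "\<dots> \<le> (\<Sum>i<n. (\<Sum>j\<in>UNIV. \<Sum>k<n. cmod (X j $$ (i, k)) * onorm (Q j)) * ?N)"
    using entry by (intro sum_mono) auto
  finally show "vnorm (hilbert_power n) (pencil n Q X v) \<le>
      (\<Sum>i<n. \<Sum>j\<in>UNIV. \<Sum>k<n. cmod (X j $$ (i, k)) * onorm (Q j)) * vnorm (hilbert_power n) v"
    by (simp add: sum_distrib_right)
qed

lemma sum_lessThan_add: "(\<Sum>i<n + m. f i) = (\<Sum>i<n. f i) + (\<Sum>i<m. f (n + i :: nat) :: 'a::comm_monoid_add)"
  by (induction m) (simp_all add: add.assoc)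

lemma nc_dsum_level:
  "\<lbrakk>X \<in> nc_level n; Y \<in> nc_level m\<rbrakk> \<Longrightarrow> nc_dsum X Y \<in> nc_level (n + m)"
  by (simp add: nc_level_def nc_dsum_def)

lemma nc_ballD:
  assumes "X \<in> nc_ball Q" "X \<in> nc_level n"
  shows "1 \<le> n" "opnorm (hilbert_power n) (hilbert_power n) (pencil n Q X) < 1"
proof -
  obtain m where m: "1 \<le> m" "X \<in> nc_level m" "opnorm (hilbert_power m) (hilbert_power m) (pencil m Q X) < 1"
    using assms(1) by (auto simp: nc_ball_def)
  have "m = n"
    using m(2) assms(2) unfolding nc_level_def by (metis (mono_tags) carrier_matD(1) mem_Collect_eq)
  then show "1 \<le> n" "opnorm (hilbert_power n) (hilbert_power n) (pencil n Q X) < 1"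
    using m by auto
qed

lemma nc_ball_level:
  assumes "X \<in> nc_ball Q"
  obtains n where "1 \<le> n" "X \<in> nc_level n"
  using assms by (auto simp: nc_ball_def)

text \<open>The operator \<open>Q(X \<oplus> Y)\<close> acts as \<open>Q(X)\<close> on the first \<open>n\<close> and as \<open>Q(Y)\<close> on the last \<open>m\<close>
  coordinates, so its norm is at most the larger of the two norms.\<close>

lemma nc_ball_dsum:
  fixes Q :: "'d::finite \<Rightarrow> 'r::complex_hilbert \<Rightarrow> 's::complex_hilbert"
  assumes Q: "\<forall>j. bounded_clinear (Q j)" and X: "X \<in> nc_ball Q" and Y: "Y \<in> nc_ball Q"
  shows "nc_dsum X Y \<in> nc_ball Q"
proof -
  let ?H = "\<lambda>n. hilbert_power n :: (nat \<Rightarrow> 'r) cnspace" and ?K = "\<lambda>n. hilbert_power n :: (nat \<Rightarrow> 's) cnspace"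
  obtain n m where n: "1 \<le> n" "X \<in> nc_level n" and m: "1 \<le> m" "Y \<in> nc_level m"
    using X Y by (meson nc_ball_level)
  define c where "c = max (opnorm (?H n) (?K n) (pencil n Q X)) (opnorm (?H m) (?K m) (pencil m Q Y))"
  have c1: "c < 1"
    using nc_ballD(2)[OF X n(2)] nc_ballD(2)[OF Y m(2)] by (simp add: c_def)
  note spaces = hilbert_power_complex_normed_space hilbert_power_complex_normed_space
  have c0: "0 \<le> c"
    using opnorm_nonneg[OF spaces pencil_bounded[OF Q, of n X]] by (simp add: c_def)
  have dims: "X j \<in> carrier_mat n n" "Y j \<in> carrier_mat m m" for j
    using n m by (auto simp: nc_level_def)
  have "opnorm (?H (n + m)) (?K (n + m)) (pencil (n + m) Q (nc_dsum X Y)) \<le> c"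
  proof (rule opnorm_le[OF spaces(1)])
    fix v :: "nat \<Rightarrow> 'r"
    assume v: "v \<in> vcarrier (?H (n + m))" "vnorm (?H (n + m)) v \<le> 1"
    let ?N = "\<lambda>k f. L2_set (\<lambda>i. norm (f i :: 'r)) {..<k}"
      and ?M = "\<lambda>k f. L2_set (\<lambda>i. norm (f i :: 's)) {..<k}"
    define u where "u = (\<lambda>i\<in>{..<n}. v i)"
    define w where "w = (\<lambda>i\<in>{..<m}. v (n + i))"
    have "?M n (pencil n Q X u) \<le> opnorm (?H n) (?K n) (pencil n Q X) * ?N n u"
      using opnorm_bound[OF spaces pencil_bounded[OF Q, of n X], of u] by (simp add: u_def)
    also have "\<dots> \<le> c * ?N n u"
      by (intro mult_right_mono) (auto simp: c_def)
    finally have 1: "?M n (pencil n Q X u) \<le> c * ?N n u" .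
    have "?M m (pencil m Q Y w) \<le> opnorm (?H m) (?K m) (pencil m Q Y) * ?N m w"
      using opnorm_bound[OF spaces pencil_bounded[OF Q, of m Y], of w] by (simp add: w_def)
    also have "\<dots> \<le> c * ?N m w"
      by (intro mult_right_mono) (auto simp: c_def)
    finally have 2: "?M m (pencil m Q Y w) \<le> c * ?N m w" .
    have sq: "(L2_set f {..<k})\<^sup>2 = (\<Sum>i<k. (f i)\<^sup>2)" for f and k :: nat
      by (simp add: L2_set_def sum_nonneg)
    have top: "pencil (n + m) Q (nc_dsum X Y) v i = pencil n Q X u i" if "i < n" for i
      using that dims[THEN carrier_matD(1)] dims[THEN carrier_matD(2)]
      by (simp add: pencil_def sum_lessThan_add nc_dsum_def u_def)
    have bot: "pencil (n + m) Q (nc_dsum X Y) v (n + i) = pencil m Q Y w i" if "i < m" for i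
      using that dims[THEN carrier_matD(1)] dims[THEN carrier_matD(2)]
      by (simp add: pencil_def sum_lessThan_add nc_dsum_def w_def)
    have "(?M (n + m) (pencil (n + m) Q (nc_dsum X Y) v))\<^sup>2 =
        (?M n (pencil n Q X u))\<^sup>2 + (?M m (pencil m Q Y w))\<^sup>2"
      unfolding sq sum_lessThan_add using top bot by simp
    also have "\<dots> \<le> (c * ?N n u)\<^sup>2 + (c * ?N m w)\<^sup>2"
      by (intro add_mono power_mono 1 2) auto
    also have "\<dots> = c\<^sup>2 * ((?N n u)\<^sup>2 + (?N m w)\<^sup>2)"
      by (simp add: power_mult_distrib distrib_left)
    also have "(?N n u)\<^sup>2 + (?N m w)\<^sup>2 = (?N (n + m) v)\<^sup>2"
      unfolding sq sum_lessThan_add by (simp add: u_def w_def)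
    also have "c\<^sup>2 * (?N (n + m) v)\<^sup>2 \<le> c\<^sup>2 * 1"
      using v(2) by (intro mult_left_mono) (auto simp: power_le_one)
    finally have "(?M (n + m) (pencil (n + m) Q (nc_dsum X Y) v))\<^sup>2 \<le> c\<^sup>2"
      by simp
    then show "vnorm (?K (n + m)) (pencil (n + m) Q (nc_dsum X Y) v) \<le> c"
      using c0 by (simp add: power2_le_iff_abs_le)
  qed
  then show ?thesis
    using c1 n(1) nc_dsum_level[OF n(2) m(2)] by (auto simp: nc_ball_def intro!: bexI[of _ "n + m"])
qed

lemma nc_set_nc_ball:
  assumes "\<forall>j. bounded_clinear (Q j)"
  shows "nc_set (nc_ball Q)"
proof -
  have "nc_ball Q \<subseteq> nc_universe"
    by (auto simp: nc_universe_def nc_ball_def)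
  then show ?thesis
    using nc_ball_dsum[OF assms] by (simp add: nc_set_def)
qed

text \<open>The suprema over the ball that define the norm of \<open>H\<^sup>\<infinity>\<close> are suprema of nonempty sets.\<close>

lemma zero_in_nc_ball: "(\<lambda>_. 0\<^sub>m 1 1) \<in> nc_ball Q"
proof -
  have "opnorm (hilbert_power 1) (hilbert_power 1) (pencil 1 Q (\<lambda>_. 0\<^sub>m 1 1)) \<le> 0"
    by (rule opnorm_le[OF hilbert_power_complex_normed_space]) (simp add: pencil_def L2_set_def)
  then show ?thesis
    by (auto simp: nc_ball_def nc_level_def intro!: bexI[of _ 1])
qed

section \<open>Bounded noncommutative functions form a normed space\<close>

abbreviation mat_dsum :: "complex mat \<Rightarrow> complex mat \<Rightarrow> complex mat" where
  "mat_dsum A B \<equiv> four_block_mat A (0\<^sub>m (dim_row A) (dim_col B)) (0\<^sub>m (dim_row B) (dim_col A)) B"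

text \<open>This is what makes \<open>A \<mapsto> S\<^sup>-\<^sup>1 A S\<close> a linear map of \<open>M\<^sub>n\<close> into itself.\<close>

lemma GL_inverse_carrier:
  assumes "S \<in> GL n"
  shows "the (mat_inverse S) \<in> carrier_mat n n"
proof -
  have S: "S \<in> carrier_mat n n" "invertible_mat S"
    using assms by (auto simp: GL_def)
  obtain B where B: "S * B = 1\<^sub>m n" "B * S = 1\<^sub>m (dim_row B)"
    using S by (auto simp: invertible_mat_def inverts_mat_def)
  have "dim_col B = n"
    using arg_cong[OF B(1), of dim_col] by simp
  moreover have "dim_row B = n"
    using arg_cong[OF B(2), of dim_col] S by simp
  ultimately have "S \<in> Units (ring_mat TYPE(complex) n ())"
    using S B by (auto simp: Units_def ring_mat_def intro!: bexI[of _ B])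
  then show ?thesis
    using mat_inverse(1)[OF S(1), where b = "()"] mat_inverse(2)[OF S(1)] by (cases "mat_inverse S") auto
qed

lemma nc_sim_level:
  "\<lbrakk>S \<in> GL n; X \<in> nc_level n\<rbrakk> \<Longrightarrow> nc_sim S X \<in> nc_level n"
  using GL_inverse_carrier[of S n]
  by (auto simp: nc_level_def nc_sim_def GL_def intro!: mult_carrier_mat[of _ n n _ n])

lemma H_infinity_sel [simp]:
  "vadd (H_infinity Q) F G = (\<lambda>X\<in>nc_ball Q. F X + G X)"
  "vscale (H_infinity Q) a F = (\<lambda>X\<in>nc_ball Q. a \<cdot>\<^sub>m F X)"
  "vnorm (H_infinity Q) F = (SUP X\<in>nc_ball Q. mat_norm (F X))"
  by (simp_all add: H_infinity_def)

lemma H_infinityD: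
  assumes "F \<in> vcarrier (H_infinity Q)"
  shows "F \<in> extensional (nc_ball Q)"
    and "\<lbrakk>X \<in> nc_ball Q; X \<in> nc_level n\<rbrakk> \<Longrightarrow> F X \<in> carrier_mat n n"
    and "\<lbrakk>X \<in> nc_ball Q; Y \<in> nc_ball Q\<rbrakk> \<Longrightarrow> F (nc_dsum X Y) = mat_dsum (F X) (F Y)"
    and "\<lbrakk>S \<in> GL n; X \<in> nc_ball Q; X \<in> nc_level n; nc_sim S X \<in> nc_ball Q\<rbrakk> \<Longrightarrow>
      F (nc_sim S X) = the (mat_inverse S) * F X * S"
    and "X \<in> nc_ball Q \<Longrightarrow> mat_norm (F X) \<le> vnorm (H_infinity Q) F"
proof -
  have F: "F \<in> extensional (nc_ball Q)" "nc_function (nc_ball Q) (\<lambda>X (_::unit). F X)"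
    "bdd_above ((\<lambda>X. mat_norm (F X)) ` nc_ball Q)"
    using assms by (auto simp: H_infinity_def)
  show "F \<in> extensional (nc_ball Q)"
    by fact
  show "\<lbrakk>X \<in> nc_ball Q; X \<in> nc_level n\<rbrakk> \<Longrightarrow> F X \<in> carrier_mat n n"
  proof -
    assume X: "X \<in> nc_ball Q" "X \<in> nc_level n"
    then have "(\<lambda>_::unit. F X) \<in> nc_level n"
      using F(2) nc_ballD(1)[OF X] unfolding nc_function_def by blast
    then show ?thesis
      by (simp add: nc_level_def)
  qed
  show "F (nc_dsum X Y) = mat_dsum (F X) (F Y)" if "X \<in> nc_ball Q" "Y \<in> nc_ball Q"
  proof -
    have "(\<lambda>_::unit. F (nc_dsum X Y)) = nc_dsum (\<lambda>_. F X) (\<lambda>_. F Y)"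
      using F(2) that unfolding nc_function_def by blast
    then show ?thesis
      unfolding nc_dsum_def[of "\<lambda>_::unit. F X"] by (rule fun_cong)
  qed
  show "F (nc_sim S X) = the (mat_inverse S) * F X * S"
    if "S \<in> GL n" "X \<in> nc_ball Q" "X \<in> nc_level n" "nc_sim S X \<in> nc_ball Q"
  proof -
    have "(\<lambda>_::unit. F (nc_sim S X)) = nc_sim S (\<lambda>_. F X)"
      using F(2) that nc_ballD(1)[OF that(2,3)] nc_sim_level[OF that(1,3)]
      unfolding nc_function_def by blast
    then show ?thesis
      unfolding nc_sim_def[of S "\<lambda>_::unit. F X"] by (rule fun_cong)
  qed
  show "X \<in> nc_ball Q \<Longrightarrow> mat_norm (F X) \<le> vnorm (H_infinity Q) F"
    unfolding H_infinity_sel by (rule cSUP_upper[OF _ F(3)])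
qed

lemma H_infinityI:
  assumes "\<forall>j. bounded_clinear (Q j)"
    and "F \<in> extensional (nc_ball Q)"
    and "\<And>n X. \<lbrakk>X \<in> nc_ball Q; X \<in> nc_level n\<rbrakk> \<Longrightarrow> F X \<in> carrier_mat n n"
    and "\<And>X Y. \<lbrakk>X \<in> nc_ball Q; Y \<in> nc_ball Q\<rbrakk> \<Longrightarrow> F (nc_dsum X Y) = mat_dsum (F X) (F Y)"
    and "\<And>n S X. \<lbrakk>S \<in> GL n; X \<in> nc_ball Q; X \<in> nc_level n; nc_sim S X \<in> nc_ball Q\<rbrakk> \<Longrightarrow>
      F (nc_sim S X) = the (mat_inverse S) * F X * S"
    and "\<And>X. X \<in> nc_ball Q \<Longrightarrow> mat_norm (F X) \<le> C"
  shows "F \<in> vcarrier (H_infinity Q)"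
proof -
  have "nc_function (nc_ball Q) (\<lambda>X (_::unit). F X)"
    unfolding nc_function_def
  proof (intro conjI ballI allI impI nc_set_nc_ball[OF assms(1)])
    fix n :: nat
    show "(\<lambda>X (_::unit). F X) ` (nc_ball Q \<inter> nc_level n) \<subseteq> nc_level n"
      using assms(3) by (auto simp: nc_level_def)
  next
    fix X Y assume "X \<in> nc_ball Q" "Y \<in> nc_ball Q"
    then show "(\<lambda>_::unit. F (nc_dsum X Y)) = nc_dsum (\<lambda>_. F X) (\<lambda>_. F Y)"
      by (simp add: assms(4) nc_dsum_def[of "\<lambda>_::unit. F X"])
  next
    fix n S X assume "S \<in> GL n" "X \<in> nc_ball Q \<inter> nc_level n" "nc_sim S X \<in> nc_ball Q \<inter> nc_level n"
    then show "(\<lambda>_::unit. F (nc_sim S X)) = nc_sim S (\<lambda>_. F X)"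
      using assms(5)[of S n X] by (simp add: nc_sim_def[of S "\<lambda>_::unit. F X"])
  qed
  moreover have "bdd_above ((\<lambda>X. mat_norm (F X)) ` nc_ball Q)"
    using assms(6) by (rule bdd_aboveI2)
  ultimately show ?thesis
    using assms(2) by (simp add: H_infinity_def)
qed

lemma H_infinity_norm_le:
  assumes "\<And>X. X \<in> nc_ball Q \<Longrightarrow> mat_norm (F X) \<le> C"
  shows "vnorm (H_infinity Q) F \<le> C"
  unfolding H_infinity_sel by (rule cSUP_least) (use zero_in_nc_ball assms in auto)

lemma mat_dsum_add:
  assumes "A \<in> carrier_mat n n" "B \<in> carrier_mat n n" "C \<in> carrier_mat m m" "D \<in> carrier_mat m m"
  shows "mat_dsum A C + mat_dsum B D = mat_dsum (A + B) (C + D)"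
  using assms by (intro eq_matI) auto

lemma mat_dsum_smult:
  assumes "A \<in> carrier_mat n n" "B \<in> carrier_mat m m"
  shows "a \<cdot>\<^sub>m mat_dsum A B = mat_dsum (a \<cdot>\<^sub>m A) (a \<cdot>\<^sub>m B)"
  using assms by (intro eq_matI) auto

lemma similarity_add:
  fixes T S A B :: "complex mat"
  assumes "T \<in> carrier_mat n n" "S \<in> carrier_mat n n" "A \<in> carrier_mat n n" "B \<in> carrier_mat n n"
  shows "T * (A + B) * S = T * A * S + T * B * S"
  using assms by (simp add: mult_add_distrib_mat[of T n n A n B]
      add_mult_distrib_mat[of "T * A" n n "T * B" S n])

lemma similarity_smult:
  fixes T S A :: "complex mat"
  assumes "T \<in> carrier_mat n n" "S \<in> carrier_mat n n" "A \<in> carrier_mat n n"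
  shows "T * (a \<cdot>\<^sub>m A) * S = a \<cdot>\<^sub>m (T * A * S)"
  using assms by (simp add: mult_smult_distrib[of T n n A n] mult_smult_assoc_mat[of "T * A" n n S n])

lemma H_infinity_complex_normed_space:
  assumes Q: "\<forall>j. bounded_clinear (Q j)"
  shows "complex_normed_space (H_infinity Q)"
proof -
  let ?H = "H_infinity Q"
  have eqI: "F = G" if "F \<in> extensional (nc_ball Q)" "G \<in> extensional (nc_ball Q)"
    "\<And>X n. \<lbrakk>X \<in> nc_ball Q; X \<in> nc_level n\<rbrakk> \<Longrightarrow> F X = G X" for F G :: "('a \<Rightarrow> complex mat) \<Rightarrow> complex mat"
    by (rule extensionalityI[OF that(1,2)]) (metis nc_ball_level that(3))
  have norm0: "0 \<le> vnorm ?H F" if "F \<in> vcarrier ?H" for F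
  proof -
    have "0 \<le> mat_norm (F (\<lambda>_. 0\<^sub>m 1 1))"
      by (rule mat_norm_nonneg[OF H_infinityD(2)[OF that zero_in_nc_ball, of 1]]) (simp add: nc_level_def)
    then show ?thesis
      using H_infinityD(5)[OF that zero_in_nc_ball] by simp
  qed
  have scale_bound: "mat_norm (a \<cdot>\<^sub>m F X) \<le> cmod a * vnorm ?H F"
    if F: "F \<in> vcarrier ?H" and X: "X \<in> nc_ball Q" for a F X
  proof -
    obtain n where n: "X \<in> nc_level n"
      using X by (rule nc_ball_level)
    show ?thesis
      using mat_norm_smult[OF H_infinityD(2)[OF F X n]] H_infinityD(5)[OF F X]
      by (simp add: mult_left_mono del: H_infinity_sel)
  qed
  have scale_closed: "vscale ?H a F \<in> vcarrier ?H" if F: "F \<in> vcarrier ?H" for a F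
  proof (rule H_infinityI[OF Q])
    fix X Y assume XY: "X \<in> nc_ball Q" "Y \<in> nc_ball Q"
    obtain n m where "X \<in> nc_level n" "Y \<in> nc_level m"
      using XY by (meson nc_ball_level)
    then show "vscale ?H a F (nc_dsum X Y) = mat_dsum (vscale ?H a F X) (vscale ?H a F Y)"
      using XY nc_ball_dsum[OF Q XY] H_infinityD(3)[OF F XY]
        mat_dsum_smult[OF H_infinityD(2)[OF F, of X n] H_infinityD(2)[OF F, of Y m]] by simp
  next
    fix n S X assume *: "S \<in> GL n" "X \<in> nc_ball Q" "X \<in> nc_level n" "nc_sim S X \<in> nc_ball Q"
    then show "vscale ?H a F (nc_sim S X) = the (mat_inverse S) * vscale ?H a F X * S"
      using H_infinityD(4)[OF F *] GL_inverse_carrier[OF *(1)] H_infinityD(2)[OF F *(2,3)]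
      by (simp add: similarity_smult GL_def)
  next
    fix X assume "X \<in> nc_ball Q"
    then show "mat_norm (vscale ?H a F X) \<le> cmod a * vnorm ?H F"
      using scale_bound[OF F] by (simp del: H_infinity_sel(3))
  qed (use H_infinityD(2)[OF F] in auto)
  have scale_norm_le: "vnorm ?H (vscale ?H a F) \<le> cmod a * vnorm ?H F" if "F \<in> vcarrier ?H" for a F
    by (rule H_infinity_norm_le) (use scale_bound[OF that] in \<open>simp del: H_infinity_sel(3)\<close>)
  have scale_one: "vscale ?H 1 F = F" if "F \<in> vcarrier ?H" for F
    by (rule eqI) (use H_infinityD(1)[OF that] in auto)
  have add_bound: "mat_norm (F X + G X) \<le> vnorm ?H F + vnorm ?H G"
    if F: "F \<in> vcarrier ?H" and G: "G \<in> vcarrier ?H" and X: "X \<in> nc_ball Q" for F G X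
  proof -
    obtain n where n: "X \<in> nc_level n"
      using X by (rule nc_ball_level)
    show ?thesis
      using mat_norm_add_le[OF H_infinityD(2)[OF F X n] H_infinityD(2)[OF G X n]]
        H_infinityD(5)[OF F X] H_infinityD(5)[OF G X] by linarith
  qed
  show ?thesis
  proof
    fix F G assume F: "F \<in> vcarrier ?H" and G: "G \<in> vcarrier ?H"
    show "vadd ?H F G \<in> vcarrier ?H"
    proof (rule H_infinityI[OF Q])
      fix X Y assume XY: "X \<in> nc_ball Q" "Y \<in> nc_ball Q"
      obtain n m where "X \<in> nc_level n" "Y \<in> nc_level m"
        using XY by (meson nc_ball_level)
      then show "vadd ?H F G (nc_dsum X Y) = mat_dsum (vadd ?H F G X) (vadd ?H F G Y)"
        using XY nc_ball_dsum[OF Q XY] H_infinityD(3)[OF F XY] H_infinityD(3)[OF G XY]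
          mat_dsum_add[OF H_infinityD(2)[OF F, of X n] H_infinityD(2)[OF G, of X n]
            H_infinityD(2)[OF F, of Y m] H_infinityD(2)[OF G, of Y m]] by simp
    next
      fix n S X assume *: "S \<in> GL n" "X \<in> nc_ball Q" "X \<in> nc_level n" "nc_sim S X \<in> nc_ball Q"
      then show "vadd ?H F G (nc_sim S X) = the (mat_inverse S) * vadd ?H F G X * S"
        using H_infinityD(4)[OF F *] H_infinityD(4)[OF G *] GL_inverse_carrier[OF *(1)]
          H_infinityD(2)[OF F *(2,3)] H_infinityD(2)[OF G *(2,3)]
        by (simp add: similarity_add GL_def)
    next
      fix X assume "X \<in> nc_ball Q"
      then show "mat_norm (vadd ?H F G X) \<le> vnorm ?H F + vnorm ?H G"
        using add_bound[OF F G] by (simp del: H_infinity_sel(3))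
    qed (use H_infinityD(2)[OF F] H_infinityD(2)[OF G] in auto)
    show "vadd ?H F G = vadd ?H G F"
      by (rule eqI) (auto intro: comm_add_mat[OF H_infinityD(2)[OF F] H_infinityD(2)[OF G]])
    show "vnorm ?H (vadd ?H F G) \<le> vnorm ?H F + vnorm ?H G"
      by (rule H_infinity_norm_le) (use add_bound[OF F G] in \<open>simp del: H_infinity_sel(3)\<close>)
    show "vscale ?H a (vadd ?H F G) = vadd ?H (vscale ?H a F) (vscale ?H a G)" for a
      by (rule eqI) (auto intro: add_smult_distrib_left_mat[OF H_infinityD(2)[OF F] H_infinityD(2)[OF G]])
    fix K assume K: "K \<in> vcarrier ?H"
    show "vadd ?H (vadd ?H F G) K = vadd ?H F (vadd ?H G K)"
      by (rule eqI) (auto intro: assoc_add_mat[OF H_infinityD(2)[OF F] H_infinityD(2)[OF G]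
            H_infinityD(2)[OF K]])
  next
    fix F a b assume F: "F \<in> vcarrier ?H"
    show "vscale ?H a F \<in> vcarrier ?H"
      by (rule scale_closed[OF F])
    show "vscale ?H 1 F = F"
      by (rule scale_one[OF F])
    show "vscale ?H a (vscale ?H b F) = vscale ?H (a * b) F"
      by (rule eqI) (auto intro!: eq_matI)
    show "vscale ?H (a + b) F = vadd ?H (vscale ?H a F) (vscale ?H b F)"
      by (rule eqI) (auto intro: add_smult_distrib_right_mat[OF H_infinityD(2)[OF F]])
    show "vnorm ?H (vscale ?H a F) = cmod a * vnorm ?H F"
    proof (cases "a = 0")
      case True
      then show ?thesis
        using scale_norm_le[OF F, of 0] norm0[OF scale_closed[OF F, of 0]] by (simp del: H_infinity_sel)
    next
      case False
      have "vscale ?H (1 / a) (vscale ?H a F) = vscale ?H 1 F"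
        by (rule eqI) (use False in \<open>auto intro!: eq_matI\<close>)
      then have "vnorm ?H F \<le> cmod (1 / a) * vnorm ?H (vscale ?H a F)"
        using scale_norm_le[OF scale_closed[OF F], of "1 / a" a] scale_one[OF F] by (simp del: H_infinity_sel)
      then show ?thesis
        using scale_norm_le[OF F, of a] False by (simp add: norm_divide field_simps del: H_infinity_sel)
    qed
  next
    fix F assume F: "F \<in> vcarrier ?H" "vnorm ?H F = 0"
    show "vscale ?H 0 F = F"
    proof (rule eqI)
      fix X n assume X: "X \<in> nc_ball Q" "X \<in> nc_level n"
      note FX = H_infinityD(2)[OF F(1) X]
      have "mat_norm (F X) = 0"
        using H_infinityD(5)[OF F(1) X(1)] F(2) mat_norm_nonneg[OF FX] by simp
      then show "vscale ?H 0 F X = F X"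
        using mat_norm_eq_0[OF FX] X(1) by auto
    qed (use H_infinityD(1)[OF F(1)] in auto)
  next
    \<comment> \<open>All coordinates of a tuple have the same size, which is read off from an arbitrary one.\<close>
    let ?Z = "\<lambda>X\<in>nc_ball Q. 0\<^sub>m (dim_row (X undefined)) (dim_row (X undefined)) :: complex mat"
    have level: "?Z X = 0\<^sub>m n n" if "X \<in> nc_ball Q" "X \<in> nc_level n" for X n
      using that by (auto simp: nc_level_def)
    have "?Z \<in> vcarrier ?H"
    proof (rule H_infinityI[OF Q])
      fix X Y assume XY: "X \<in> nc_ball Q" "Y \<in> nc_ball Q"
      obtain n m where nm: "X \<in> nc_level n" "Y \<in> nc_level m"
        using XY by (meson nc_ball_level)
      show "?Z (nc_dsum X Y) = mat_dsum (?Z X) (?Z Y)"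
        unfolding level[OF XY(1) nm(1)] level[OF XY(2) nm(2)]
          level[OF nc_ball_dsum[OF Q XY] nc_dsum_level[OF nm]]
        by simp
    next
      fix n S X assume *: "S \<in> GL n" "X \<in> nc_ball Q" "X \<in> nc_level n" "nc_sim S X \<in> nc_ball Q"
      show "?Z (nc_sim S X) = the (mat_inverse S) * ?Z X * S"
        unfolding level[OF *(2,3)] level[OF *(4) nc_sim_level[OF *(1,3)]]
        using GL_inverse_carrier[OF *(1)] *(1) by (auto simp: GL_def left_mult_zero_mat[of S n n])
    next
      fix X assume X: "X \<in> nc_ball Q"
      then obtain n where n: "X \<in> nc_level n"
        by (rule nc_ball_level)
      show "mat_norm (?Z X) \<le> 0"
        unfolding level[OF X n] using mat_norm_smult_le[of "0\<^sub>m n n" n 0] by simp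
    qed (use level in auto)
    moreover have "vscale ?H 0 F = ?Z" if F: "F \<in> vcarrier ?H" for F
    proof (rule eqI)
      fix X n assume X: "X \<in> nc_ball Q" "X \<in> nc_level n"
      show "vscale ?H 0 F X = ?Z X"
        unfolding level[OF X] using X(1) H_infinityD(2)[OF F X] by auto
    qed auto
    ultimately show "\<exists>Z\<in>vcarrier ?H. \<forall>F\<in>vcarrier ?H. vscale ?H 0 F = Z"
      by blast
  qed
qed

section \<open>Point functionals and their closed span\<close>

text \<open>The functional is bounded only on the closed span \<open>K\<close> itself, so its kernel is a subspace of
  \<open>K\<close> that contains the span of \<open>A\<close>, and boundedness extends the conclusion to limits.\<close>

lemma (in complex_normed_space) functional_vanishes_on_closed_span:
  assumes A: "A \<subseteq> \<C>"
    and f: "f \<in> vcarrier (dual_space (V\<lparr>vcarrier :=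
      Abstract_Topology.closure_of (norm_topology V) (vspan V A)\<rparr>))" (is "f \<in> vcarrier (dual_space ?K)")
    and zero: "\<And>a. a \<in> A \<Longrightarrow> f a = 0"
    and x: "x \<in> Abstract_Topology.closure_of (norm_topology V) (vspan V A)"
  shows "f x = 0"
proof (rule ccontr)
  assume "f x \<noteq> 0"
  note span = vsubspace_vspan[OF A]
  note span_sub = vsubspaceD(1)[OF span]
  note K = vsubspace_closure[OF span]
  note KD = vsubspaceD[OF K]
  note space = subspace_complex_normed_space[OF K]
  have span_K: "vspan V A \<subseteq> vcarrier ?K"
    using closure_of_subset[of "vspan V A" "norm_topology V"] span_sub by simp
  have add: "f (y \<boxplus> z) = f y + f z" if "y \<in> vcarrier ?K" "z \<in> vcarrier ?K" for y z
    using dual_spaceD(2)[OF f that] by simp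
  have scale: "f (a \<boxdot> y) = a * f y" if "y \<in> vcarrier ?K" for y a
    using dual_spaceD(3)[OF f that] by simp
  have "f \<zero>\<^sub>V = 0"
    using scale[of "\<zero>\<^sub>V" 0] KD(4) by simp
  then have "vsubspace V {y \<in> vcarrier ?K. f y = 0}"
    unfolding vsubspace_def using KD add scale by auto
  then have "vspan V A \<subseteq> {y \<in> vcarrier ?K. f y = 0}"
    unfolding vspan_def using zero hull_subset[of A "vsubspace V"] span_K
    by (intro hull_minimal) (auto simp: vspan_def)
  then have span0: "f u = 0" if "u \<in> vspan V A" for u
    using that by auto
  define N where "N = vnorm (dual_space ?K) f"
  have N: "0 \<le> N"
    unfolding N_def by (rule dual_norm_nonneg[OF space f])
  have "0 < cmod (f x) / (N + 1)"
    using N \<open>f x \<noteq> 0\<close> by simp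
  then obtain u where u: "u \<in> vspan V A" "\<parallel>x \<boxplus> (- 1) \<boxdot> u\<parallel> < cmod (f x) / (N + 1)"
    using x unfolding closure_of_norm_topology[OF span_sub] by blast
  have uK: "u \<in> vcarrier ?K" and xK: "x \<in> vcarrier ?K"
    using u(1) span_K x by auto
  then have diff: "x \<boxplus> (- 1) \<boxdot> u \<in> vcarrier ?K"
    using KD by simp
  have "f (x \<boxplus> (- 1) \<boxdot> u) = f x"
    using add[OF xK, of "(- 1) \<boxdot> u"] scale[OF uK, of "- 1"] span0[OF u(1)] uK KD(3) by simp
  then have "cmod (f x) \<le> N * \<parallel>x \<boxplus> (- 1) \<boxdot> u\<parallel>"
    using dual_space_bound[OF space f diff] by (simp add: N_def)
  also have "\<dots> \<le> (N + 1) * \<parallel>x \<boxplus> (- 1) \<boxdot> u\<parallel>"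
    using KD(1) diff by (intro mult_right_mono norm_nonneg) auto
  also have "\<dots> < cmod (f x)"
    using u(2) N by (simp add: pos_less_divide_eq mult.commute)
  finally show False
    by simp
qed

context
  fixes Q :: "'d::finite \<Rightarrow> 'r::complex_hilbert \<Rightarrow> 's::complex_hilbert"
  assumes Q: "\<forall>j. bounded_clinear (Q j)"
begin

interpretation H: complex_normed_space "H_infinity Q"
  by (rule H_infinity_complex_normed_space[OF Q])

interpretation D: complex_normed_space "dual_space (H_infinity Q)"
  by (rule dual_space_complex_normed_space) (rule H.complex_normed_space_axioms)

abbreviation (input) "\<H> \<equiv> H_infinity Q"
abbreviation (input) "\<D> \<equiv> dual_space (H_infinity Q)"

definition point_functionals :: "((('d \<Rightarrow> complex mat) \<Rightarrow> complex mat) \<Rightarrow> complex) set" where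
  "point_functionals = {eval_functional Q X \<eta> | n X \<eta>.
     1 \<le> n \<and> X \<in> nc_ball Q \<inter> nc_level n \<and> \<eta> \<in> vcarrier (dual_space (mat_space n))}"

lemma canonical_predual_eq:
  "canonical_predual Q = Abstract_Topology.closure_of (norm_topology \<D>) (vspan \<D> point_functionals)"
  by (simp add: canonical_predual_def point_functionals_def)

lemma eval_functional_eq: "eval_functional Q X \<eta> = (\<lambda>F\<in>vcarrier \<H>. \<eta> (F X))"
  by (simp add: eval_functional_def evaluation_def)

lemma eval_functional_bound:
  assumes X: "X \<in> nc_ball Q" "X \<in> nc_level n" and \<eta>: "\<eta> \<in> vcarrier (dual_space (mat_space n))"
    and F: "F \<in> vcarrier \<H>"
  shows "cmod (\<eta> (F X)) \<le> vnorm (dual_space (mat_space n)) \<eta> * vnorm \<H> F"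
proof -
  have "cmod (\<eta> (F X)) \<le> vnorm (dual_space (mat_space n)) \<eta> * mat_norm (F X)"
    using dual_space_bound[OF mat_space_complex_normed_space \<eta>, of "F X"] H_infinityD(2)[OF F X] by simp
  also have "\<dots> \<le> vnorm (dual_space (mat_space n)) \<eta> * vnorm \<H> F"
    by (intro mult_left_mono H_infinityD(5)[OF F X(1)]
        dual_norm_nonneg[OF mat_space_complex_normed_space \<eta>])
  finally show ?thesis .
qed

lemma eval_functional_in_dual:
  assumes X: "X \<in> nc_ball Q" "X \<in> nc_level n" and \<eta>: "\<eta> \<in> vcarrier (dual_space (mat_space n))"
  shows "eval_functional Q X \<eta> \<in> vcarrier \<D>"
  unfolding mem_dual_space linear_functional_iff
proof (intro conjI ballI allI exI[of _ "vnorm (dual_space (mat_space n)) \<eta>"])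
  fix F assume F: "F \<in> vcarrier \<H>"
  then show "cmod (eval_functional Q X \<eta> F) \<le> vnorm (dual_space (mat_space n)) \<eta> * vnorm \<H> F"
    using eval_functional_bound[OF X \<eta> F] by (simp add: eval_functional_eq del: H_infinity_sel)
  show "eval_functional Q X \<eta> (vscale \<H> a F) = a * eval_functional Q X \<eta> F" for a
    using dual_spaceD(3)[OF \<eta>, of "F X" a] H_infinityD(2)[OF F X] F X(1) H.scale_closed[OF F, of a]
    by (simp add: eval_functional_eq)
  fix G assume G: "G \<in> vcarrier \<H>"
  show "eval_functional Q X \<eta> (vadd \<H> F G) = eval_functional Q X \<eta> F + eval_functional Q X \<eta> G"
    using dual_spaceD(2)[OF \<eta>, of "F X" "G X"] H_infinityD(2)[OF F X] H_infinityD(2)[OF G X] F G X(1)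
      H.add_closed[OF F G]
    by (simp add: eval_functional_eq)
qed (simp add: eval_functional_eq)

lemma point_functionals_subset: "point_functionals \<subseteq> vcarrier \<D>"
  using eval_functional_in_dual by (auto simp: point_functionals_def)

lemma point_functionalsI:
  "\<lbrakk>X \<in> nc_ball Q; X \<in> nc_level n; \<eta> \<in> vcarrier (dual_space (mat_space n))\<rbrakk> \<Longrightarrow>
     eval_functional Q X \<eta> \<in> point_functionals"
  using nc_ballD(1)[of X Q n] by (auto simp: point_functionals_def)

lemma canonical_predual_subspace: "vsubspace \<D> (canonical_predual Q)"
  unfolding canonical_predual_eq by (intro D.vsubspace_closure D.vsubspace_vspan point_functionals_subset)

lemma canonical_predual_closed: "closedin (norm_topology \<D>) (canonical_predual Q)"
  unfolding canonical_predual_eq by simp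

lemma point_functionals_subset_canonical: "point_functionals \<subseteq> canonical_predual Q"
proof -
  have "vspan \<D> point_functionals \<subseteq> canonical_predual Q"
    unfolding canonical_predual_eq
    using D.vsubspaceD(1)[OF D.vsubspace_vspan[OF point_functionals_subset]]
    by (intro closure_of_subset) simp
  moreover have "point_functionals \<subseteq> vspan \<D> point_functionals"
    unfolding vspan_def by (rule hull_subset)
  ultimately show ?thesis
    by simp
qed

lemma canonical_predual_least:
  assumes "vsubspace \<D> K" "closedin (norm_topology \<D>) K" "point_functionals \<subseteq> K"
  shows "canonical_predual Q \<subseteq> K"
  unfolding canonical_predual_eq vspan_def
  by (intro closure_of_minimal hull_minimal assms)

section \<open>The canonical map is isometric\<close>

text \<open>A vector functional of unit vectors gives a point functional of norm at most one, and these
  functionals recover the norm of every value \<open>F X\<close>.\<close>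

lemma vector_point_functional_norm_le:
  assumes X: "X \<in> nc_ball Q" "X \<in> nc_level n"
    and u: "u \<in> carrier_vec n" "vec_norm u \<le> 1" and v: "v \<in> carrier_vec n" "vec_norm v \<le> 1"
  shows "vnorm \<D> (eval_functional Q X (vector_functional n u v)) \<le> 1"
proof (rule dual_norm_le[OF H.complex_normed_space_axioms])
  fix F assume F: "F \<in> vcarrier \<H>" "vnorm \<H> F \<le> 1"
  have "cmod (vector_functional n u v (F X)) \<le> mat_norm (F X)"
    by (rule vector_functional_le[OF H_infinityD(2)[OF F(1) X] u v])
  also have "\<dots> \<le> 1"
    using H_infinityD(5)[OF F(1) X(1)] F(2) by linarith
  finally show "cmod (eval_functional Q X (vector_functional n u v) F) \<le> 1"
    using F(1) by (simp add: eval_functional_eq)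
qed

text \<open>All that the following arguments use of the canonical predual is that it is a subspace which
  contains the point functionals.\<close>

context
  fixes K
  assumes K: "vsubspace \<D> K" and point_K: "point_functionals \<subseteq> K"
begin

abbreviation (input) "\<K> \<equiv> \<D>\<lparr>vcarrier := K\<rparr>"

lemma subspace_space: "complex_normed_space \<K>"
  by (rule D.subspace_complex_normed_space[OF K])

lemma subspace_in_dual: "\<phi> \<in> K \<Longrightarrow> \<phi> \<in> vcarrier \<D>"
  using D.vsubspaceD(1)[OF K] by auto

lemma canonical_map_bound:
  assumes "F \<in> vcarrier \<H>" "\<phi> \<in> K"
  shows "cmod (\<phi> F) \<le> vnorm \<H> F * vnorm \<D> \<phi>"
  using dual_space_bound[OF H.complex_normed_space_axioms subspace_in_dual[OF assms(2)] assms(1)]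
  by (simp add: mult.commute)

lemma canonical_map_in_dual:
  assumes F: "F \<in> vcarrier \<H>"
  shows "(\<lambda>\<phi>\<in>K. \<phi> F) \<in> vcarrier (dual_space \<K>)"
  unfolding mem_dual_space linear_functional_iff
  using D.vsubspaceD[OF K] canonical_map_bound[OF F] F
  by (auto intro!: exI[of _ "vnorm \<H> F"])

lemma canonical_map_isometric:
  assumes F: "F \<in> vcarrier \<H>"
  shows "vnorm (dual_space \<K>) (\<lambda>\<phi>\<in>K. \<phi> F) = vnorm \<H> F"
proof (rule antisym)
  let ?N = "vnorm (dual_space \<K>) (\<lambda>\<phi>\<in>K. \<phi> F)"
  have N0: "0 \<le> ?N"
    by (rule dual_norm_nonneg[OF subspace_space canonical_map_in_dual[OF F]])
  show "?N \<le> vnorm \<H> F"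
  proof (rule dual_norm_le[OF subspace_space])
    fix \<phi> assume "\<phi> \<in> vcarrier \<K>" "vnorm \<K> \<phi> \<le> 1"
    then have \<phi>: "\<phi> \<in> K" "vnorm \<D> \<phi> \<le> 1"
      by simp_all
    have "vnorm \<H> F * vnorm \<D> \<phi> \<le> vnorm \<H> F"
      using \<phi>(2) H.norm_nonneg[OF F] by (intro mult_left_le) auto
    then show "cmod ((\<lambda>\<phi>\<in>K. \<phi> F) \<phi>) \<le> vnorm \<H> F"
      using canonical_map_bound[OF F \<phi>(1)] \<phi>(1) by simp
  qed
  show "vnorm \<H> F \<le> ?N"
  proof (rule H_infinity_norm_le)
    fix X assume X: "X \<in> nc_ball Q"
    then obtain n where n: "X \<in> nc_level n"
      by (rule nc_ball_level)
    show "mat_norm (F X) \<le> ?N"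
    proof (rule mat_norm_le_if_vector_functional_le[OF H_infinityD(2)[OF F X n] N0])
      fix u v assume u: "u \<in> carrier_vec n" "vec_norm u \<le> 1" and v: "v \<in> carrier_vec n" "vec_norm v \<le> 1"
      let ?\<phi> = "eval_functional Q X (vector_functional n u v)"
      have \<phi>: "?\<phi> \<in> K"
        using point_functionalsI[OF X n vector_functional_in_dual[OF u(1)]] point_K by auto
      have "cmod (?\<phi> F) \<le> ?N * vnorm \<D> ?\<phi>"
        using dual_space_bound[OF subspace_space canonical_map_in_dual[OF F], of ?\<phi>] \<phi> by simp
      also have "\<dots> \<le> ?N"
        using vector_point_functional_norm_le[OF X n u v] N0 by (intro mult_left_le) auto
      finally show "cmod (vector_functional n u v (F X)) \<le> ?N"
        using F by (simp add: eval_functional_eq)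
    qed
  qed
qed

lemma canonical_map_linear: "linear_map \<H> (dual_space \<K>) (\<lambda>F. \<lambda>\<phi>\<in>K. \<phi> F)"
  unfolding linear_map_def
proof (intro conjI ballI allI funcsetI canonical_map_in_dual)
  fix F G assume "F \<in> vcarrier \<H>" "G \<in> vcarrier \<H>"
  then show "(\<lambda>\<phi>\<in>K. \<phi> (vadd \<H> F G)) = vadd (dual_space \<K>) (\<lambda>\<phi>\<in>K. \<phi> F) (\<lambda>\<phi>\<in>K. \<phi> G)"
    using dual_spaceD(2)[OF subspace_in_dual] by (auto simp: fun_eq_iff)
next
  fix a F assume "F \<in> vcarrier \<H>"
  then show "(\<lambda>\<phi>\<in>K. \<phi> (vscale \<H> a F)) = vscale (dual_space \<K>) a (\<lambda>\<phi>\<in>K. \<phi> F)"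
    using dual_spaceD(3)[OF subspace_in_dual] by (auto simp: fun_eq_iff)
qed

lemma annihilated_eq_zero:
  assumes F: "F \<in> vcarrier \<H>" and zero: "\<And>\<phi>. \<phi> \<in> K \<Longrightarrow> \<phi> F = 0"
  shows "F = H.zero"
proof -
  have "vnorm (dual_space \<K>) (\<lambda>\<phi>\<in>K. \<phi> F) \<le> 0"
    by (rule dual_norm_le[OF subspace_space]) (use zero in simp)
  then show ?thesis
    using canonical_map_isometric[OF F] H.norm_nonneg[OF F] H.norm_eq_zero[OF F] by linarith
qed

lemma canonical_map_inj: "inj_on (\<lambda>F. \<lambda>\<phi>\<in>K. \<phi> F) (vcarrier \<H>)"
proof (rule inj_onI)
  fix F G assume FG: "F \<in> vcarrier \<H>" "G \<in> vcarrier \<H>" "(\<lambda>\<phi>\<in>K. \<phi> F) = (\<lambda>\<phi>\<in>K. \<phi> G)"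
  have "\<phi> (vadd \<H> F (vscale \<H> (- 1) G)) = 0" if "\<phi> \<in> K" for \<phi>
    using dual_spaceD(2,3)[OF subspace_in_dual[OF that]] FG(1,2) H.scale_closed[OF FG(2), of "- 1"]
      fun_cong[OF FG(3), of \<phi>] that by (simp del: H_infinity_sel)
  then show "F = G"
    using annihilated_eq_zero[of "vadd \<H> F (vscale \<H> (- 1) G)"] FG(1,2) H.diff_eq_zero[OF FG(1,2)]
    by (simp del: H_infinity_sel)
qed

section \<open>Every functional on the predual is an evaluation\<close>

text \<open>
  A functional \<open>\<Lambda>\<close> prescribes the matrix \<open>F X\<close> entrywise. By linearity \<open>\<Lambda>\<close> then agrees with
  evaluation at \<open>F\<close> on all point functionals, and the relations that make \<open>F\<close> noncommutative
  hold because they are already equalities between point functionals.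
\<close>

lemma functional_represented_on_points:
  assumes \<Lambda>: "\<Lambda> \<in> vcarrier (dual_space \<K>)"
  obtains F where "F \<in> vcarrier \<H>" "\<And>\<phi>. \<phi> \<in> point_functionals \<Longrightarrow> \<Lambda> \<phi> = \<phi> F"
proof -
  note KD = D.vsubspaceD[OF K]
  have \<Lambda>_add: "\<Lambda> (vadd \<D> \<phi> \<psi>) = \<Lambda> \<phi> + \<Lambda> \<psi>" if "\<phi> \<in> K" "\<psi> \<in> K" for \<phi> \<psi>
    using dual_spaceD(2)[OF \<Lambda>, of \<phi> \<psi>] that by simp
  have \<Lambda>_scale: "\<Lambda> (vscale \<D> a \<phi>) = a * \<Lambda> \<phi>" if "\<phi> \<in> K" for \<phi> a
    using dual_spaceD(3)[OF \<Lambda>, of \<phi> a] that by simp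
  have zero: "(\<lambda>F\<in>vcarrier \<H>. 0) \<in> K" "\<Lambda> (\<lambda>F\<in>vcarrier \<H>. 0) = 0"
  proof -
    have eq: "(\<lambda>F\<in>vcarrier \<H>. 0) = vscale \<D> 0 D.zero"
      by (simp add: fun_eq_iff del: D.scale_zero_left D.scale_zero_right)
    show "(\<lambda>F\<in>vcarrier \<H>. 0) \<in> K"
      unfolding eq by (rule KD(3)[OF KD(4)])
    show "\<Lambda> (\<lambda>F\<in>vcarrier \<H>. 0) = 0"
      unfolding eq \<Lambda>_scale[OF KD(4)] by simp
  qed
  define e where "e X p = (\<lambda>F\<in>vcarrier \<H>. F X $$ p)" for X :: "'d \<Rightarrow> complex mat" and p
  have e: "e X p \<in> K"
    if X: "X \<in> nc_ball Q" "X \<in> nc_level n" and p: "p \<in> {..<n} \<times> {..<n}" for X n p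
  proof -
    have "e X p = eval_functional Q X (entry_functional n p)"
      using H_infinityD(2)[OF _ X] by (auto simp: e_def eval_functional_eq entry_functional_def)
    then show ?thesis
      using point_functionalsI[OF X entry_functional_in_dual[OF p]] point_K by auto
  qed
  define comb where "comb X c S = (\<lambda>F\<in>vcarrier \<H>. \<Sum>p\<in>S. c p * F X $$ p)"
    for X :: "'d \<Rightarrow> complex mat" and c S
  have combination: "comb X c S \<in> K \<and> \<Lambda> (comb X c S) = (\<Sum>p\<in>S. c p * \<Lambda> (e X p))"
    if X: "X \<in> nc_ball Q" "X \<in> nc_level n" and "finite S" "S \<subseteq> {..<n} \<times> {..<n}" for X n S c
    using that(3,4)
  proof induction
    case empty
    have eq: "comb X c {} = (\<lambda>F\<in>vcarrier \<H>. 0)"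
      by (simp add: comb_def fun_eq_iff)
    show ?case
      unfolding eq sum.empty using zero by blast
  next
    case (insert p S)
    have "e X p \<in> K"
      using e[OF X] insert.prems by auto
    moreover have "comb X c (insert p S) = vadd \<D> (vscale \<D> (c p) (e X p)) (comb X c S)"
      using insert.hyps by (simp add: fun_eq_iff e_def comb_def)
    ultimately show ?case
      using insert KD(2,3) \<Lambda>_add \<Lambda>_scale by (simp del: dual_space_sel)
  qed
  \<comment> \<open>The size of \<open>X\<close> is read off from an arbitrary coordinate.\<close>
  define F where "F = (\<lambda>X\<in>nc_ball Q. mat (dim_row (X undefined)) (dim_row (X undefined)) (\<lambda>p. \<Lambda> (e X p)))"
  have F: "F X = mat n n (\<lambda>p. \<Lambda> (e X p))" if "X \<in> nc_ball Q" "X \<in> nc_level n" for X n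
    using that by (auto simp: F_def nc_level_def)
  have point: "\<Lambda> (eval_functional Q X \<eta>) = \<eta> (F X)"
    if X: "X \<in> nc_ball Q" "X \<in> nc_level n" and \<eta>: "\<eta> \<in> vcarrier (dual_space (mat_space n))" for X n \<eta>
  proof -
    let ?I = "{..<n} \<times> {..<n}"
    have lin: "linear_map (mat_space n) complex_field_space \<eta>"
      using \<eta> by (simp add: mem_dual_space)
    have "eval_functional Q X \<eta> = comb X (\<lambda>p. \<eta> (matrix_unit n p)) ?I"
      using mat_functional_expansion[OF lin H_infinityD(2)[OF _ X]]
      by (auto simp: comb_def eval_functional_eq mult.commute)
    then have "\<Lambda> (eval_functional Q X \<eta>) = (\<Sum>p\<in>?I. \<eta> (matrix_unit n p) * \<Lambda> (e X p))"
      using combination[OF X, of ?I "\<lambda>p. \<eta> (matrix_unit n p)"] by simp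
    also have "\<dots> = (\<Sum>p\<in>?I. F X $$ p * \<eta> (matrix_unit n p))"
      unfolding F[OF X] by (intro sum.cong) auto
    also have "\<dots> = \<eta> (F X)"
      by (rule mat_functional_expansion[OF lin, symmetric]) (simp add: F[OF X])
    finally show ?thesis .
  qed
  define N where "N = vnorm (dual_space \<K>) \<Lambda>"
  have N: "0 \<le> N"
    unfolding N_def by (rule dual_norm_nonneg[OF subspace_space \<Lambda>])
  have "F \<in> vcarrier \<H>"
  proof (rule H_infinityI[OF Q])
    show "F \<in> extensional (nc_ball Q)"
      by (simp add: F_def)
    show "F X \<in> carrier_mat n n" if "X \<in> nc_ball Q" "X \<in> nc_level n" for X n
      by (simp add: F[OF that])
  next
    fix X Y assume X: "X \<in> nc_ball Q" and Y: "Y \<in> nc_ball Q"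
    obtain n m where nm: "X \<in> nc_level n" "Y \<in> nc_level m"
      using X Y by (meson nc_ball_level)
    note FX = F[OF X nm(1)] and FY = F[OF Y nm(2)]
    have FXY: "F (nc_dsum X Y) = mat (n + m) (n + m) (\<lambda>p. \<Lambda> (e (nc_dsum X Y) p))"
      by (rule F[OF nc_ball_dsum[OF Q X Y] nc_dsum_level[OF nm]])
    have dims: "dim_row (G X) = n" "dim_col (G X) = n" "dim_row (G Y) = m" "dim_col (G Y) = m"
      if "G \<in> vcarrier \<H>" for G
      using H_infinityD(2)[OF that X nm(1)] H_infinityD(2)[OF that Y nm(2)] by auto
    have e_dsum: "e (nc_dsum X Y) (i, j) =
        (if i < n then if j < n then e X (i, j) else (\<lambda>F\<in>vcarrier \<H>. 0)
         else if j < n then (\<lambda>F\<in>vcarrier \<H>. 0) else e Y (i - n, j - n))"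
      if "i < n + m" "j < n + m" for i j
    proof
      fix G show "e (nc_dsum X Y) (i, j) G = (if i < n
          then if j < n then e X (i, j) else (\<lambda>F\<in>vcarrier \<H>. 0)
          else if j < n then (\<lambda>F\<in>vcarrier \<H>. 0) else e Y (i - n, j - n)) G"
      proof (cases "G \<in> vcarrier \<H>")
        case True
        then show ?thesis
          using that dims[OF True] H_infinityD(3)[OF True X Y] by (simp add: e_def)
      qed (simp add: e_def)
    qed
    show "F (nc_dsum X Y) = mat_dsum (F X) (F Y)"
      unfolding FX FY FXY
      by (intro eq_matI) (auto simp: e_dsum zero(2))
  next
    fix n S X
    assume S: "S \<in> GL n" and X: "X \<in> nc_ball Q" "X \<in> nc_level n" and SX: "nc_sim S X \<in> nc_ball Q"
    let ?T = "the (mat_inverse S)"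
    have carriers: "?T \<in> carrier_mat n n" "S \<in> carrier_mat n n"
      using GL_inverse_carrier[OF S] S by (auto simp: GL_def)
    have FX: "F X \<in> carrier_mat n n"
      by (simp add: F[OF X])
    show "F (nc_sim S X) = ?T * F X * S"
      unfolding F[OF SX nc_sim_level[OF S X(2)]]
    proof (rule eq_matI)
      fix i j assume "i < dim_row (?T * F X * S)" "j < dim_col (?T * F X * S)"
      then have ij: "i < n" "j < n"
        using carriers by auto
      define \<eta> where "\<eta> = (\<lambda>A\<in>carrier_mat n n. (?T * A * S) $$ (i, j))"
      have dims: "?T * A * S \<in> carrier_mat n n" if "A \<in> carrier_mat n n" for A
        using carriers that by auto
      have "\<eta> \<in> vcarrier (dual_space (mat_space n))"
      proof (rule mat_functional_in_dual)
        have "(?T * A * S + ?T * B * S) $$ (i, j) = (?T * A * S) $$ (i, j) + (?T * B * S) $$ (i, j)"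
          if "A \<in> carrier_mat n n" "B \<in> carrier_mat n n" for A B
          by (rule index_add_mat(1)) (use dims[OF that(2)] ij in auto)
        moreover have "(a \<cdot>\<^sub>m (?T * A * S)) $$ (i, j) = a * (?T * A * S) $$ (i, j)"
          if "A \<in> carrier_mat n n" for A a
          by (rule index_smult_mat(1)) (use dims[OF that] ij in auto)
        ultimately show "linear_map (mat_space n) complex_field_space \<eta>"
          by (simp add: linear_functional_iff \<eta>_def similarity_add[OF carriers] similarity_smult[OF carriers])
      qed (simp add: \<eta>_def)
      then have "\<Lambda> (eval_functional Q X \<eta>) = \<eta> (F X)"
        by (rule point[OF X])
      moreover have "e (nc_sim S X) (i, j) = eval_functional Q X \<eta>"
        using H_infinityD(4)[OF _ S X SX] H_infinityD(2)[OF _ X]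
        by (auto simp: e_def eval_functional_eq \<eta>_def)
      ultimately show "mat n n (\<lambda>p. \<Lambda> (e (nc_sim S X) p)) $$ (i, j) = (?T * F X * S) $$ (i, j)"
        using ij FX by (simp add: \<eta>_def)
    qed (use carriers in auto)
  next
    fix X assume X: "X \<in> nc_ball Q"
    then obtain n where n: "X \<in> nc_level n"
      by (rule nc_ball_level)
    have FX: "F X \<in> carrier_mat n n"
      by (simp add: F[OF X n])
    show "mat_norm (F X) \<le> N"
    proof (rule mat_norm_le_if_vector_functional_le[OF FX N])
      fix u v assume u: "u \<in> carrier_vec n" "vec_norm u \<le> 1" and v: "v \<in> carrier_vec n" "vec_norm v \<le> 1"
      let ?\<phi> = "eval_functional Q X (vector_functional n u v)"
      have "?\<phi> \<in> K"
        using point_functionalsI[OF X n vector_functional_in_dual[OF u(1)]] point_K by auto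
      then have "cmod (\<Lambda> ?\<phi>) \<le> N * vnorm \<D> ?\<phi>"
        using dual_space_bound[OF subspace_space \<Lambda>, of ?\<phi>] by (simp add: N_def)
      also have "\<dots> \<le> N"
        using vector_point_functional_norm_le[OF X n u v] N by (intro mult_left_le) auto
      finally show "cmod (vector_functional n u v (F X)) \<le> N"
        using point[OF X n vector_functional_in_dual[OF u(1)]] by simp
    qed
  qed
  moreover have "\<Lambda> \<phi> = \<phi> F" if \<phi>: "\<phi> \<in> point_functionals" for \<phi>
  proof -
    obtain n X \<eta> where *: "\<phi> = eval_functional Q X \<eta>" "X \<in> nc_ball Q" "X \<in> nc_level n"
      "\<eta> \<in> vcarrier (dual_space (mat_space n))"
      using \<phi> by (auto simp: point_functionals_def)
    then show ?thesis
      using point[OF *(2-4)] \<open>F \<in> vcarrier \<H>\<close> by (simp add: eval_functional_eq)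
  qed
  ultimately show thesis
    by (rule that)
qed

section \<open>Continuity of the evaluations\<close>

text \<open>The matrix norm of \<open>F X - G X\<close> is at most the sum of the moduli of its entries, and the
  entries of \<open>F X\<close> are point functionals of \<open>F\<close>.\<close>

lemma evaluations_continuous_if_point_functionals: "evaluations_continuous Q K"
  unfolding evaluations_continuous_def
proof (intro allI impI ballI)
  fix n and X :: "'d \<Rightarrow> complex mat" assume "X \<in> nc_ball Q \<inter> nc_level n"
  then have X: "X \<in> nc_ball Q" "X \<in> nc_level n"
    by auto
  interpret M: complex_normed_space "mat_space n"
    by (rule mat_space_complex_normed_space)
  let ?W = "weak_topology \<H> K"
  have topspace: "topspace ?W = vcarrier \<H>"
    by (auto simp: weak_topology_def)
  have weak: "continuous_map ?W euclidean \<phi>" if "\<phi> \<in> K" for \<phi>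
    unfolding continuous_map_def topspace
  proof (intro conjI allI impI)
    fix U :: "complex set" assume "openin euclidean U"
    then show "openin ?W {F \<in> vcarrier \<H>. \<phi> F \<in> U}"
      unfolding weak_topology_def using that by (intro topology_generated_by_Basis) auto
  qed auto
  have "continuous_map ?W euclidean (\<lambda>F. F X $$ p)" if p: "p \<in> {..<n} \<times> {..<n}" for p
  proof (rule continuous_map_eq)
    show "continuous_map ?W euclidean (eval_functional Q X (entry_functional n p))"
      using point_functionalsI[OF X entry_functional_in_dual[OF p]] point_K by (intro weak) auto
    show "eval_functional Q X (entry_functional n p) F = F X $$ p" if "F \<in> topspace ?W" for F
      using that H_infinityD(2)[OF _ X] by (simp add: topspace eval_functional_eq entry_functional_def)
  qed
  then have entries: "continuous_map ?W euclidean (\<lambda>F. F X $$ (i, k))" if "i < n" "k < n" for i k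
    using that by simp
  show "continuous_map ?W (norm_topology (mat_space n)) (evaluation X)"
    unfolding norm_topology_def M.metric.continuous_map_to_metric
  proof (intro ballI allI impI)
    fix F and \<epsilon> :: real assume "F \<in> topspace ?W" and \<epsilon>: "0 < \<epsilon>"
    then have F: "F \<in> vcarrier \<H>"
      by (simp add: topspace)
    define d where "d G = (\<Sum>i<n. \<Sum>k<n. cmod (F X $$ (i, k) - G X $$ (i, k)))"
      for G :: "('d \<Rightarrow> complex mat) \<Rightarrow> complex mat"
    have "continuous_map ?W euclideanreal d"
      unfolding d_def
      by (intro continuous_map_sum continuous_map_norm continuous_map_diff entries) auto
    then have "openin ?W {G \<in> topspace ?W. d G \<in> {..<\<epsilon>}}"
      by (rule openin_continuous_map_preimage) simp
    moreover have "F \<in> {G \<in> topspace ?W. d G \<in> {..<\<epsilon>}}"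
      using F \<epsilon> by (simp add: topspace d_def)
    moreover have "evaluation X G \<in> M.metric.mball (evaluation X F) \<epsilon>"
      if "G \<in> {G \<in> topspace ?W. d G \<in> {..<\<epsilon>}}" for G
    proof -
      have G: "G \<in> vcarrier \<H>" "d G < \<epsilon>"
        using that by (auto simp: topspace)
      note FX = H_infinityD(2)[OF F X] and GX = H_infinityD(2)[OF G(1) X]
      have "mat_norm (F X + (- 1) \<cdot>\<^sub>m G X) \<le> (\<Sum>i<n. \<Sum>k<n. cmod ((F X + (- 1) \<cdot>\<^sub>m G X) $$ (i, k)))"
        by (rule mat_norm_le_sum_entries) (use FX GX in auto)
      also have "\<dots> = d G"
        unfolding d_def using FX GX by (intro sum.cong) auto
      finally show ?thesis
        using G(2) FX GX unfolding M.metric.in_mball by (simp add: evaluation_def vdist_def)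
    qed
    ultimately show "\<exists>U. openin ?W U \<and> F \<in> U \<and>
        (\<forall>G\<in>U. evaluation X G \<in> M.metric.mball (evaluation X F) \<epsilon>)"
      by blast
  qed
qed

end

theorem canonical_predual_is_predual: "predual \<H> (canonical_predual Q)"
proof -
  note K = canonical_predual_subspace point_functionals_subset_canonical
  let ?K = "\<D>\<lparr>vcarrier := canonical_predual Q\<rparr>" and ?c = "\<lambda>F. \<lambda>\<phi>\<in>canonical_predual Q. \<phi> F"
  have "\<Lambda> \<in> ?c ` vcarrier \<H>" if \<Lambda>: "\<Lambda> \<in> vcarrier (dual_space ?K)" for \<Lambda>
  proof -
    interpret KD: complex_normed_space "dual_space ?K"
      by (rule dual_space_complex_normed_space[OF D.subspace_complex_normed_space[OF K(1)]])
    obtain F where F: "F \<in> vcarrier \<H>" "\<And>\<phi>. \<phi> \<in> point_functionals \<Longrightarrow> \<Lambda> \<phi> = \<phi> F"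
      using functional_represented_on_points[OF K \<Lambda>] by blast
    \<comment> \<open>The difference \<open>\<Delta>\<close> vanishes on the point functionals, hence on their closed span.\<close>
    define \<Delta> where "\<Delta> = vadd (dual_space ?K) \<Lambda> (vscale (dual_space ?K) (- 1) (?c F))"
    have \<Delta>: "\<Delta> \<in> vcarrier (dual_space ?K)"
      unfolding \<Delta>_def by (intro KD.add_closed KD.scale_closed \<Lambda> canonical_map_in_dual[OF K F(1)])
    have \<Delta>_eq: "\<Delta> \<phi> = \<Lambda> \<phi> - \<phi> F" if "\<phi> \<in> canonical_predual Q" for \<phi>
      using that by (simp add: \<Delta>_def)
    have "\<Delta> \<phi> = 0" if "\<phi> \<in> canonical_predual Q" for \<phi>
    proof (rule D.functional_vanishes_on_closed_span[where f = \<Delta>, OF point_functionals_subset])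
      show "\<Delta> \<psi> = 0" if "\<psi> \<in> point_functionals" for \<psi>
        using \<Delta>_eq[of \<psi>] F(2)[OF that] that K(2) by auto
    qed (use \<Delta> that in \<open>simp_all add: canonical_predual_eq\<close>)
    then have "\<Lambda> = ?c F"
      using \<Delta>_eq dual_spaceD(1)[OF \<Lambda>] by (intro extensionalityI[of _ "canonical_predual Q"]) auto
    then show ?thesis
      using F(1) by blast
  qed
  then have "?c ` vcarrier \<H> = vcarrier (dual_space ?K)"
    using canonical_map_in_dual[OF K] by blast
  then have "isometric_isomorphism \<H> (dual_space ?K) ?c"
    unfolding isometric_isomorphism_def bij_betw_def
    using canonical_map_linear[OF K] canonical_map_inj[OF K] canonical_map_isometric[OF K] by blast
  then show ?thesis
    unfolding predual_def using canonical_predual_subspace canonical_predual_closed by blast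
qed

section \<open>Uniqueness\<close>

text \<open>
  The preimage of the unit ball of \<open>M\<^sub>n\<close> under \<open>\<Phi>\<^sub>X\<close> is a \<open>\<sigma>(\<H>, K)\<close>-neighbourhood of \<open>0\<close>, so it
  contains the intersection of the kernels of finitely many members of \<open>K\<close>. This intersection is
  a linear space with bounded image, so \<open>F X = 0\<close> and \<open>\<phi>\<^bsub>X,\<eta>\<^esub>(F) = 0\<close> for every \<open>F\<close> in it.
\<close>

lemma point_functionals_subset_if_continuous:
  assumes K: "vsubspace \<D> K" and cont: "evaluations_continuous Q K"
  shows "point_functionals \<subseteq> K"
proof
  fix \<psi> assume "\<psi> \<in> point_functionals"
  then obtain n X \<eta> where \<psi>: "\<psi> = eval_functional Q X \<eta>" and n: "1 \<le> n"
    and X: "X \<in> nc_ball Q" "X \<in> nc_level n" and \<eta>: "\<eta> \<in> vcarrier (dual_space (mat_space n))"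
    by (auto simp: point_functionals_def)
  interpret M: complex_normed_space "mat_space n"
    by (rule mat_space_complex_normed_space)
  let ?W = "weak_topology \<H> K"
  let ?B = "M.metric.mball M.zero 1"
  have topspace: "topspace ?W = vcarrier \<H>"
    by (auto simp: weak_topology_def)
  have scale_eval: "(vscale \<H> a F) X = vscale (mat_space n) a (F X)" for a F
    using X(1) by simp
  have zero: "H.zero X = M.zero"
    using scale_eval[of 0 H.zero] H_infinityD(2)[OF H.zero_closed X]
      M.scale_zero_left[of "H.zero X"] by (simp del: H_infinity_sel)
  have "continuous_map ?W (norm_topology (mat_space n)) (evaluation X)"
    using cont n X by (simp add: evaluations_continuous_def)
  then have "openin ?W {F \<in> topspace ?W. evaluation X F \<in> ?B}"
    unfolding norm_topology_def by (rule openin_continuous_map_preimage[OF _ M.metric.openin_mball])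
  moreover have "H.zero \<in> {F \<in> topspace ?W. evaluation X F \<in> ?B}"
    unfolding mem_Collect_eq evaluation_def zero M.metric.centre_in_mball_iff
    by (simp add: topspace del: mat_space_sel)
  ultimately obtain A where A: "finite A" "A \<subseteq> K"
    "\<And>F. \<lbrakk>F \<in> vcarrier \<H>; \<And>\<phi>. \<phi> \<in> A \<Longrightarrow> \<phi> F = \<phi> H.zero\<rbrakk> \<Longrightarrow> F \<in> {F \<in> topspace ?W. evaluation X F \<in> ?B}"
    by (rule weak_open_finite_functionals) blast
  have A_dual: "\<phi> \<in> vcarrier \<D>" if "\<phi> \<in> A" for \<phi>
    using that A(2) D.vsubspaceD(1)[OF K] by auto
  show "\<psi> \<in> K"
  proof (rule H.functional_in_subspace_if_vanishes_on_kernels[OF K A(1,2)])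
    show "\<psi> \<in> vcarrier \<D>"
      unfolding \<psi> by (rule eval_functional_in_dual[OF X \<eta>])
    fix F assume F: "F \<in> vcarrier \<H>" and F0: "\<And>\<phi>. \<phi> \<in> A \<Longrightarrow> \<phi> F = 0"
    note FX = H_infinityD(2)[OF F X]
    \<comment> \<open>All multiples of \<open>F\<close> lie in the neighbourhood, whose image lies in the unit ball.\<close>
    have less: "cmod a * mat_norm (F X) < 1" for a
    proof -
      have "\<phi> (vscale \<H> a F) = \<phi> H.zero" if "\<phi> \<in> A" for \<phi>
        using dual_spaceD(3)[OF A_dual[OF that] F, of a] F0[OF that]
          dual_spaceD(3)[OF A_dual[OF that] H.zero_closed, of 0] by (simp del: H_infinity_sel)
      then have "vscale \<H> a F \<in> {F \<in> topspace ?W. evaluation X F \<in> ?B}"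
        using A(3)[of "vscale \<H> a F"] H.scale_closed[OF F] by blast
      then have "vdist (mat_space n) M.zero (vscale (mat_space n) a (F X)) < 1"
        by (simp only: mem_Collect_eq M.metric.in_mball evaluation_def scale_eval)
      moreover have "vscale (mat_space n) a (F X) \<in> vcarrier (mat_space n)"
        using FX by simp
      ultimately have "vnorm (mat_space n) (vscale (mat_space n) a (F X)) < 1"
        using M.norm_minus[of "vscale (mat_space n) a (F X)"] M.scale_closed
          M.add_zero_left[of "vscale (mat_space n) (- 1) (vscale (mat_space n) a (F X))"]
        by (simp add: vdist_def del: mat_space_sel)
      then show ?thesis
        using mat_norm_smult[OF FX] by simp
    qed
    have "mat_norm (F X) = 0"
    proof (rule ccontr)
      assume "mat_norm (F X) \<noteq> 0"
      then show False
        using less[of "complex_of_real (1 / mat_norm (F X))"] mat_norm_nonneg[OF FX]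
        by (simp add: norm_divide)
    qed
    then have "cmod (\<eta> (F X)) \<le> 0"
      using dual_space_bound[OF mat_space_complex_normed_space \<eta>, of "F X"] FX by simp
    then show "\<psi> F = 0"
      using F by (simp add: \<psi> eval_functional_eq)
  qed
qed

text \<open>
  A predual \<open>K\<close> that contained the canonical one properly would carry a nonzero functional that
  vanishes on the canonical one. It would be evaluation at some \<open>F\<close>, which must be zero because the
  canonical predual determines \<open>F\<close>.
\<close>

theorem canonical_predual_unique:
  assumes pre: "predual \<H> K" and cont: "evaluations_continuous Q K"
  shows "K = canonical_predual Q"
proof (rule antisym)
  let ?C = "canonical_predual Q" and ?K = "\<D>\<lparr>vcarrier := K\<rparr>"
  have K: "vsubspace \<D> K" "closedin (norm_topology \<D>) K"
    and iso: "isometric_isomorphism \<H> (dual_space ?K) (\<lambda>F. \<lambda>\<phi>\<in>K. \<phi> F)"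
    using pre by (auto simp: predual_def)
  show sub: "?C \<subseteq> K"
    by (intro canonical_predual_least K point_functionals_subset_if_continuous cont)
  interpret K: complex_normed_space ?K
    by (rule D.subspace_complex_normed_space[OF K(1)])
  have KD: "K \<subseteq> vcarrier \<D>"
    by (rule D.vsubspaceD(1)[OF K(1)])
  show "K \<subseteq> ?C"
  proof
    fix \<phi> assume \<phi>: "\<phi> \<in> K"
    show "\<phi> \<in> ?C"
    proof (rule ccontr)
      assume "\<phi> \<notin> ?C"
      moreover have "vsubspace ?K ?C"
        using canonical_predual_subspace sub unfolding vsubspace_def by simp
      moreover have "closedin (norm_topology ?K) ?C"
        using canonical_predual_closed KD sub
        unfolding D.closedin_norm_topology K.closedin_norm_topology by auto
      ultimately obtain f where f: "f \<in> vcarrier (dual_space ?K)" "\<And>u. u \<in> ?C \<Longrightarrow> f u = 0" "f \<phi> \<noteq> 0"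
        using K.separating_functional[of ?C \<phi>] \<phi> by auto
      have "f \<in> (\<lambda>F. \<lambda>\<phi>\<in>K. \<phi> F) ` vcarrier \<H>"
        using iso f(1) by (simp add: isometric_isomorphism_def bij_betw_def)
      then obtain F where F: "F \<in> vcarrier \<H>" "f = (\<lambda>\<phi>\<in>K. \<phi> F)"
        by blast
      have "F = H.zero"
      proof (rule annihilated_eq_zero[OF canonical_predual_subspace point_functionals_subset_canonical F(1)])
        fix \<psi> assume "\<psi> \<in> ?C"
        then show "\<psi> F = 0"
          using f(2)[of \<psi>] F(2) sub by auto
      qed
      moreover have "\<phi> H.zero = 0"
        using dual_spaceD(3)[of \<phi> \<H> H.zero 0] \<phi> KD by (auto simp del: H_infinity_sel)
      ultimately show False
        using f(3) F(2) \<phi> by simp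
    qed
  qed
qed

end

theorem theorem3p1:
  fixes Q :: "'d::finite \<Rightarrow> 'r::complex_hilbert \<Rightarrow> 's::complex_hilbert"
  assumes "\<And>j. bounded_clinear (Q j)"
    and "clin_independent Q"
  shows "predual (H_infinity Q) (canonical_predual Q) \<and>
    evaluations_continuous Q (canonical_predual Q) \<and>
    (\<forall>\<X>. predual (H_infinity Q) \<X> \<and> evaluations_continuous Q \<X> \<longrightarrow> \<X> = canonical_predual Q)"
proof -
  have Q: "\<forall>j. bounded_clinear (Q j)"
    using assms(1) by blast
  show ?thesis
    using canonical_predual_is_predual[OF Q] canonical_predual_unique[OF Q]
      evaluations_continuous_if_point_functionals[OF Q canonical_predual_subspace[OF Q]
        point_functionals_subset_canonical[OF Q]]
    by blast
qed

end
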